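(* For every $k\ge3$, the following problem is undecidable: given a finite $k$-dimensional weighted game $G=(S_0,S_1,E)$, an initial state $s_{\mathrm{init}}\in S$, and a threshold $t\in\mathbb Q^k$, determine whether $P_0$ has a winning strategy from $s_{\mathrm{init}}$ for the objective $\mathrm{AE}(t)=\{\pi \mid \overline{\mathrm{AE}}(\pi)\le t\}$ (no bounds on the energy level).
   Context: A $k$-dimensional weighted game is $G=(S_0,S_1,E)$ with $S_0,S_1$ finite disjoint sets of states of players $P_0,P_1$, $S=S_0\cup S_1$, and $E\subseteq S\times[-W,W]^k\times S$ a finite set of edges weighted by integer vectors; every state has an outgoing edge. Plays (infinite edge sequences $e_1e_2\cdots$ with $\mathrm{tgt}(e_i)=\mathrm{src}(e_{i+1})$) and prefixes are as usual. For a nonempty prefix $\rho=e_1\cdots e_n$, $\mathrm{EL}(\rho)=\sum_{i=1}^n w(e_i)\in\mathbb Z^k$ and $\mathrm{AE}(\rho)=\frac1n\sum_{i=1}^n\mathrm{EL}(e_1\cdots e_i)$; for a play $\pi$, $\overline{\mathrm{AE}}(\pi)$ is the componentwise $\limsup_{n\to\infty}\mathrm{AE}(\pi_{\le n})$, and $\overline{\mathrm{AE}}(\pi)\le t$ is meant componentwise. A strategy of $P_i$ maps every prefix ending in $S_i$ to an outgoing edge of its last state (arbitrary memory); a strategy of $P_0$ is winning if all its outcomes belong to the objective. *)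

theory Defs
  imports Complex_Main "HOL-Library.Extended_Real" "HOL-Library.Liminf_Limsup"
    "HOL-Library.Nat_Bijection"
begin

section \<open>Multi-dimensional weighted games\<close>

text \<open>An edge is a triple of source, weight vector and target; a vector in \<open>\<int>\<^sup>k\<close> is a list of
  length \<open>k\<close>.\<close>

type_synonym 's edge = "'s \<times> int list \<times> 's"

definition src :: "'s edge \<Rightarrow> 's" where "src e = fst e"
definition wt :: "'s edge \<Rightarrow> int list" where "wt e = fst (snd e)"
definition tgt :: "'s edge \<Rightarrow> 's" where "tgt e = snd (snd e)"

record 's game =
  states0 :: "'s set"
  states1 :: "'s set"
  edges :: "'s edge set"

definition states :: "('s, 'z) game_scheme \<Rightarrow> 's set" where
  "states G = states0 G \<union> states1 G"

definition weighted_game :: "nat \<Rightarrow> ('s, 'z) game_scheme \<Rightarrow> bool" where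
  "weighted_game k G \<longleftrightarrow>
     finite (states0 G) \<and> finite (states1 G) \<and> states0 G \<inter> states1 G = {} \<and>
     finite (edges G) \<and>
     (\<exists>W::nat. edges G \<subseteq>
        states G \<times> {w. length w = k \<and> set w \<subseteq> {- int W..int W}} \<times> states G) \<and>
     (\<forall>s\<in>states G. \<exists>e\<in>edges G. src e = s)"

definition plays :: "('s, 'z) game_scheme \<Rightarrow> (nat \<Rightarrow> 's edge) set" where
  "plays G = {\<pi>. (\<forall>i. \<pi> i \<in> edges G) \<and> (\<forall>i. tgt (\<pi> i) = src (\<pi> (Suc i)))}"

text \<open>Plays are indexed from 0, so \<open>play_prefix \<pi> n\<close> consists of the first \<open>n\<close> edges.\<close>

definition play_prefix :: "(nat \<Rightarrow> 's edge) \<Rightarrow> nat \<Rightarrow> 's edge list" where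
  "play_prefix \<pi> n = map \<pi> [0..<n]"

text \<open>Prefixes may be empty, so a prefix is given by its initial state together with its list of
  edges; this determines the last state in all cases.\<close>

fun path_from :: "('s, 'z) game_scheme \<Rightarrow> 's \<Rightarrow> 's edge list \<Rightarrow> bool" where
  "path_from G s [] \<longleftrightarrow> s \<in> states G"
| "path_from G s (e # \<rho>) \<longleftrightarrow> e \<in> edges G \<and> src e = s \<and> path_from G (tgt e) \<rho>"

definition last_state :: "'s \<Rightarrow> 's edge list \<Rightarrow> 's" where
  "last_state s \<rho> = (if \<rho> = [] then s else tgt (last \<rho>))"

definition strategy0 :: "('s, 'z) game_scheme \<Rightarrow> ('s \<Rightarrow> 's edge list \<Rightarrow> 's edge) \<Rightarrow> bool" where
  "strategy0 G \<sigma> \<longleftrightarrow>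
     (\<forall>s \<rho>. path_from G s \<rho> \<and> last_state s \<rho> \<in> states0 G \<longrightarrow>
        \<sigma> s \<rho> \<in> edges G \<and> src (\<sigma> s \<rho>) = last_state s \<rho>)"

definition outcomes0 ::
  "('s, 'z) game_scheme \<Rightarrow> ('s \<Rightarrow> 's edge list \<Rightarrow> 's edge) \<Rightarrow> 's \<Rightarrow> (nat \<Rightarrow> 's edge) set" where
  "outcomes0 G \<sigma> s =
     {\<pi>\<in>plays G. src (\<pi> 0) = s \<and>
        (\<forall>n. last_state s (play_prefix \<pi> n) \<in> states0 G \<longrightarrow> \<pi> n = \<sigma> s (play_prefix \<pi> n))}"

definition has_winning_strategy0 ::
  "('s, 'z) game_scheme \<Rightarrow> 's \<Rightarrow> (nat \<Rightarrow> 's edge) set \<Rightarrow> bool" where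
  "has_winning_strategy0 G s Obj \<longleftrightarrow> (\<exists>\<sigma>. strategy0 G \<sigma> \<and> outcomes0 G \<sigma> s \<subseteq> Obj)"

section \<open>The average-energy objective\<close>

text \<open>Component \<open>i\<close> of the energy level and of the average energy of a prefix.\<close>

definition energy_level :: "nat \<Rightarrow> 's edge list \<Rightarrow> int" where
  "energy_level i \<rho> = (\<Sum>e\<leftarrow>\<rho>. wt e ! i)"

definition average_energy :: "nat \<Rightarrow> 's edge list \<Rightarrow> real" where
  "average_energy i \<rho> =
     (\<Sum>j=1..length \<rho>. real_of_int (energy_level i (take j \<rho>))) / real (length \<rho>)"

text \<open>The limit superior is taken in the extended reals, since average energies may be
  unbounded. The value at \<open>n = 0\<close> is irrelevant for it.\<close>

definition limsup_average_energy :: "nat \<Rightarrow> (nat \<Rightarrow> 's edge) \<Rightarrow> ereal" where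
  "limsup_average_energy i \<pi> = limsup (\<lambda>n. ereal (average_energy i (play_prefix \<pi> n)))"

definition AE_objective :: "('s, 'z) game_scheme \<Rightarrow> rat list \<Rightarrow> (nat \<Rightarrow> 's edge) set" where
  "AE_objective G t =
     {\<pi>\<in>plays G. \<forall>i<length t. limsup_average_energy i \<pi> \<le> ereal (of_rat (t ! i))}"

section \<open>Decidability\<close>

text \<open>Kleene's partial recursive functions. \<open>rec_eval f xs y\<close> means that \<open>f\<close> is defined
  on the arguments \<open>xs\<close> with value \<open>y\<close>. The recursion variable of \<open>PrimRec\<close> and the
  variable searched by \<open>Mu\<close> come first in the argument list.\<close>

datatype recfun =
    Zero
  | Succ
  | Proj nat
  | Comp recfun "recfun list"
  | PrimRec recfun recfun
  | Mu recfun

inductive rec_eval :: "recfun \<Rightarrow> nat list \<Rightarrow> nat \<Rightarrow> bool" where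
  Zero: "rec_eval Zero xs 0"
| Succ: "rec_eval Succ [x] (Suc x)"
| Proj: "i < length xs \<Longrightarrow> rec_eval (Proj i) xs (xs ! i)"
| Comp: "length ys = length gs \<Longrightarrow> \<forall>i<length gs. rec_eval (gs ! i) xs (ys ! i) \<Longrightarrow>
    rec_eval f ys z \<Longrightarrow> rec_eval (Comp f gs) xs z"
| PrimRec_0: "rec_eval f xs y \<Longrightarrow> rec_eval (PrimRec f g) (0 # xs) y"
| PrimRec_Suc: "rec_eval (PrimRec f g) (n # xs) y \<Longrightarrow> rec_eval g (n # y # xs) z \<Longrightarrow>
    rec_eval (PrimRec f g) (Suc n # xs) z"
| Mu: "rec_eval f (n # xs) 0 \<Longrightarrow> \<forall>m<n. \<exists>y. rec_eval f (m # xs) (Suc y) \<Longrightarrow>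
    rec_eval (Mu f) xs n"

inductive_cases rec_eval_ZeroE: "rec_eval Zero xs y"
inductive_cases rec_eval_SuccE: "rec_eval Succ xs y"
inductive_cases rec_eval_ProjE: "rec_eval (Proj i) xs y"
inductive_cases rec_eval_CompE: "rec_eval (Comp f gs) xs y"
inductive_cases rec_eval_PrimRec_0E: "rec_eval (PrimRec f g) (0 # xs) y"
inductive_cases rec_eval_PrimRec_SucE: "rec_eval (PrimRec f g) (Suc n # xs) y"
inductive_cases rec_eval_MuE: "rec_eval (Mu f) xs y"

lemma rec_eval_deterministic: "rec_eval f xs y \<Longrightarrow> rec_eval f xs z \<Longrightarrow> y = z"
proof (induction arbitrary: z rule: rec_eval.induct)
  case (Zero xs)
  then show ?case by (rule rec_eval_ZeroE) simp
next
  case (Succ x)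
  then show ?case by (rule rec_eval_SuccE) simp
next
  case (Proj i xs)
  from Proj.prems show ?case by (rule rec_eval_ProjE) simp
next
  case (Comp ys gs xs f z z')
  from Comp.prems obtain ys' where ys': "length ys' = length gs"
    "\<forall>i<length gs. rec_eval (gs ! i) xs (ys' ! i)" "rec_eval f ys' z'"
    by (rule rec_eval_CompE)
  have "ys = ys'"
  proof (rule nth_equalityI)
    show "length ys = length ys'" using Comp.hyps(1) ys'(1) by simp
    fix i assume "i < length ys"
    then have "i < length gs" using Comp.hyps(1) by simp
    then show "ys ! i = ys' ! i" using Comp.IH(1) ys'(2) by blast
  qed
  then show ?case using Comp.IH(2) ys'(3) by blast
next
  case (PrimRec_0 f xs y g)
  from PrimRec_0.prems have "rec_eval f xs z" by (rule rec_eval_PrimRec_0E)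
  then show ?case by (rule PrimRec_0.IH)
next
  case (PrimRec_Suc f g n xs y z z')
  from PrimRec_Suc.prems obtain y' where
    "rec_eval (PrimRec f g) (n # xs) y'" "rec_eval g (n # y' # xs) z'"
    by (rule rec_eval_PrimRec_SucE)
  then show ?case using PrimRec_Suc.IH by blast
next
  case (Mu f n xs z)
  from Mu.prems have z: "rec_eval f (z # xs) 0" "\<forall>m<z. \<exists>y. rec_eval f (m # xs) (Suc y)"
    by (blast elim: rec_eval_MuE)+
  show ?case
  proof (cases n z rule: linorder_cases)
    case less
    then obtain y where "rec_eval f (n # xs) (Suc y)" using z(2) by blast
    then show ?thesis using Mu.IH(1) by fastforce
  next
    case greater
    then obtain y where "\<And>v. rec_eval f (z # xs) v \<Longrightarrow> Suc y = v" using Mu.IH(2) by blast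
    then show ?thesis using z(1) by fastforce
  qed
qed

text \<open>Decidability of the yes/no problem \<open>P\<close> on the instances \<open>I\<close>, which are presented to the
  algorithm through the encoding \<open>enc\<close>. Nothing is required of the algorithm on numbers that do
  not encode an instance.\<close>

definition decidable_problem :: "'i set \<Rightarrow> ('i \<Rightarrow> nat) \<Rightarrow> ('i \<Rightarrow> bool) \<Rightarrow> bool" where
  "decidable_problem I enc P \<longleftrightarrow> (\<exists>f. \<forall>x\<in>I. rec_eval f [enc x] (if P x then 1 else 0))"

section \<open>The decision problem\<close>

text \<open>States of game instances are natural numbers; up to renaming this covers all finite
  games.\<close>

type_synonym ae_instance = "nat game \<times> nat \<times> rat list"

definition ae_instances :: "nat \<Rightarrow> ae_instance set" where
  "ae_instances k = {(G, s, t). weighted_game k G \<and> s \<in> states G \<and> length t = k}"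

definition ae_problem :: "ae_instance \<Rightarrow> bool" where
  "ae_problem = (\<lambda>(G, s, t). has_winning_strategy0 G s (AE_objective G t))"

definition encode_edge :: "nat edge \<Rightarrow> nat" where
  "encode_edge =
     (\<lambda>(s, w, s'). prod_encode (s, prod_encode (list_encode (map int_encode w), s')))"

definition encode_game :: "nat game \<Rightarrow> nat" where
  "encode_game G =
     prod_encode (set_encode (states0 G),
       prod_encode (set_encode (states1 G), set_encode (encode_edge ` edges G)))"

definition encode_rat :: "rat \<Rightarrow> nat" where
  "encode_rat q = prod_encode (map_prod int_encode int_encode (quotient_of q))"

definition encode_instance :: "ae_instance \<Rightarrow> nat" where
  "encode_instance =
     (\<lambda>(G, s, t). prod_encode (encode_game G, prod_encode (s, list_encode (map encode_rat t))))"

text \<open>Distinct instances have distinct codes.\<close>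

lemma inj_encode_edge: "inj encode_edge"
proof (rule injI)
  fix e e' assume "encode_edge e = encode_edge e'"
  then show "e = e'"
    by (cases e; cases e') (auto simp: encode_edge_def list_encode_eq inj_map_eq_map inj_int_encode)
qed

lemma inj_encode_rat: "inj encode_rat"
proof (rule injI)
  fix p q assume "encode_rat p = encode_rat q"
  then have "quotient_of p = quotient_of q"
    by (cases "quotient_of p"; cases "quotient_of q") (auto simp: encode_rat_def int_encode_eq)
  then show "p = q" by (simp add: quotient_of_inject)
qed

lemma inj_on_encode_instance: "inj_on encode_instance (ae_instances k)"
proof (rule inj_onI)
  fix x y assume x: "x \<in> ae_instances k" and y: "y \<in> ae_instances k"
    and eq: "encode_instance x = encode_instance y"
  obtain G s t G' s' t' where xy: "x = (G, s, t)" "y = (G', s', t')"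
    by (cases x; cases y) auto
  have fin: "finite (states0 G)" "finite (states1 G)" "finite (edges G)"
    "finite (states0 G')" "finite (states1 G')" "finite (edges G')"
    using x y by (auto simp: xy ae_instances_def weighted_game_def)
  have "s = s'" "t = t'"
    using eq by (auto simp: xy encode_instance_def list_encode_eq inj_map_eq_map inj_encode_rat)
  moreover have "states0 G = states0 G'" "states1 G = states1 G'"
    "encode_edge ` edges G = encode_edge ` edges G'"
    using eq fin by (auto simp: xy encode_instance_def encode_game_def set_encode_eq)
  then have "G = G'"
    by (auto simp: inj_image_eq_iff inj_encode_edge intro: game.equality)
  ultimately show "x = y" by (simp add: xy)
qed

end

theory Submission
  imports Defs "HOL-Library.Infinite_Set" "HOL-Library.Countable"
    "HOL-Computational_Algebra.Primes"
begin

text \<open>A decision procedure \<open>f\<close> is refuted by diagonalization: for every recursive function \<open>F\<close>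
  of three arguments there is a game, a part of whose own code consists of the three arguments, that
  \<open>P\<^sub>0\<close> wins exactly if \<open>F\<close> takes the value \<open>0\<close> on them. With \<open>F\<close> computing the code of the
  instance and applying \<open>f\<close> to it, \<open>f\<close> errs on that instance. Neither a universal machine nor
  the decoding of a game is needed.

  In the game for \<open>F\<close>, \<open>P\<^sub>0\<close> asserts that \<open>F\<close> has a certain value on the contents of some
  registers and announces the values of subcomputations, of which \<open>P\<^sub>1\<close> chooses one to be examined.
  As \<open>P\<^sub>1\<close> refutes a false assertion by following a false subassertion, no stack is required.
  The registers are the exponents of the primes in a single number, which is kept in two counters, and
  these in three energy levels. When a play enters a state with a suitable loop, the averages converge to at
  most \<open>0\<close> if and only if a single energy level is at most \<open>0\<close>; with such tests \<open>P\<^sub>1\<close> punishes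
  incorrect moves. During a correct simulation the first level is positive, so \<open>P\<^sub>0\<close> has to
  end it.\<close>

section \<open>Attractors and average energies\<close>

definition shift :: "(nat \<Rightarrow> int) \<Rightarrow> int list \<Rightarrow> nat \<Rightarrow> int" where
  "shift e w = (\<lambda>i. e i + w ! i)"

text \<open>The attractor of \<open>B\<close> in the infinite graph of pairs of a state and its
  energy levels, stratified by the number of moves within which the first player can force
  \<open>B\<close>.\<close>

fun attr_rank :: "'s game \<Rightarrow> ('s \<Rightarrow> (nat \<Rightarrow> int) \<Rightarrow> bool) \<Rightarrow> nat \<Rightarrow> 's \<Rightarrow> (nat \<Rightarrow> int) \<Rightarrow> bool" where
  "attr_rank G B 0 s e \<longleftrightarrow> B s e"
| "attr_rank G B (Suc n) s e \<longleftrightarrow> attr_rank G B n s e \<or>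
     s \<in> states0 G \<and> (\<exists>d\<in>edges G. src d = s \<and> attr_rank G B n (tgt d) (shift e (wt d))) \<or>
     s \<in> states1 G \<and> (\<forall>d\<in>edges G. src d = s \<longrightarrow> attr_rank G B n (tgt d) (shift e (wt d)))"

definition attr :: "'s game \<Rightarrow> ('s \<Rightarrow> (nat \<Rightarrow> int) \<Rightarrow> bool) \<Rightarrow> 's \<Rightarrow> (nat \<Rightarrow> int) \<Rightarrow> bool" where
  "attr G B s e \<longleftrightarrow> (\<exists>n. attr_rank G B n s e)"

lemma attr_rank_mono: "attr_rank G B m s e \<Longrightarrow> m \<le> n \<Longrightarrow> attr_rank G B n s e"
  by (induction n) (auto simp: le_Suc_eq)

lemma attr_base: "B s e \<Longrightarrow> attr G B s e"
  unfolding attr_def by (rule exI[of _ 0]) simp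

lemma attr_step0:
  assumes "s \<in> states0 G" "d \<in> edges G" "src d = s" "attr G B (tgt d) (shift e (wt d))"
  shows "attr G B s e"
proof -
  obtain n where "attr_rank G B n (tgt d) (shift e (wt d))"
    using assms(4) by (auto simp: attr_def)
  then have "attr_rank G B (Suc n) s e" using assms(1-3) by auto
  then show ?thesis unfolding attr_def by blast
qed

text \<open>Only finitely many edges leave \<open>s\<close>, so the ranks of the successors have a
  maximum. Hence finite ranks suffice although the graph of configurations is infinite.\<close>

lemma attr_step1:
  assumes "s \<in> states1 G" "finite (edges G)"
    and "\<And>d. d \<in> edges G \<Longrightarrow> src d = s \<Longrightarrow> attr G B (tgt d) (shift e (wt d))"
  shows "attr G B s e"
proof -
  have "\<forall>d\<in>{d\<in>edges G. src d = s}. \<exists>n. attr_rank G B n (tgt d) (shift e (wt d))"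
    using assms(3) by (auto simp: attr_def)
  then obtain r where r: "\<forall>d\<in>{d\<in>edges G. src d = s}. attr_rank G B (r d) (tgt d) (shift e (wt d))"
    by (rule bchoice[THEN exE]) blast
  \<comment> \<open>The element \<open>0\<close> keeps the maximum meaningful if no edge leaves
    \<open>s\<close>.\<close>
  define n where "n = Max (insert 0 (r ` {d\<in>edges G. src d = s}))"
  have "attr_rank G B n (tgt d) (shift e (wt d))" if "d \<in> edges G" "src d = s" for d
  proof (rule attr_rank_mono)
    show "attr_rank G B (r d) (tgt d) (shift e (wt d))" using r that by blast
    show "r d \<le> n" unfolding n_def using that assms(2) by (intro Max_ge) auto
  qed
  then have "attr_rank G B (Suc n) s e" using assms(1) by simp
  then show ?thesis unfolding attr_def by blast
qed

lemma attr_step1D: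
  assumes "\<not> attr G B s e" "s \<in> states1 G" "finite (edges G)"
  shows "\<exists>d\<in>edges G. src d = s \<and> \<not> attr G B (tgt d) (shift e (wt d))"
  using attr_step1[OF assms(2,3)] assms(1) by metis

section \<open>Energy levels and last states along prefixes\<close>

abbreviation level :: "'s edge list \<Rightarrow> nat \<Rightarrow> int" where
  "level \<rho> \<equiv> \<lambda>i. energy_level i \<rho>"

lemma level_Nil: "level [] = (\<lambda>_. 0)"
  by (simp add: energy_level_def)

lemma level_snoc: "level (\<rho> @ [d]) = shift (level \<rho>) (wt d)"
  by (auto simp: energy_level_def shift_def)

lemma play_prefix_0: "play_prefix \<pi> 0 = []"
  by (simp add: play_prefix_def)

lemma play_prefix_Suc: "play_prefix \<pi> (Suc n) = play_prefix \<pi> n @ [\<pi> n]"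
  by (simp add: play_prefix_def)

lemma last_state_snoc: "last_state s (\<rho> @ [d]) = tgt d"
  by (simp add: last_state_def)

lemma play_src:
  assumes "\<pi> \<in> plays G" "src (\<pi> 0) = s"
  shows "last_state s (play_prefix \<pi> n) = src (\<pi> n)"
proof (cases n)
  case 0
  then show ?thesis using assms by (simp add: play_prefix_def last_state_def)
next
  case (Suc m)
  then show ?thesis using assms(1) by (simp add: play_prefix_Suc last_state_snoc plays_def)
qed

lemma path_from_snoc:
  "path_from G s (\<rho> @ [d]) \<longleftrightarrow>
     path_from G s \<rho> \<and> d \<in> edges G \<and> src d = last_state s \<rho> \<and> tgt d \<in> states G"
  if "\<forall>d\<in>edges G. src d \<in> states G \<and> tgt d \<in> states G"
  using that by (induction \<rho> arbitrary: s) (auto simp: last_state_def)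

lemma last_state_in_states:
  assumes "\<forall>d\<in>edges G. src d \<in> states G \<and> tgt d \<in> states G" "path_from G s \<rho>"
  shows "last_state s \<rho> \<in> states G"
  using assms by (cases \<rho> rule: rev_cases) (auto simp: path_from_snoc last_state_def)

lemma strategy0_of_choice:
  assumes "\<And>s e. s \<in> states0 G \<Longrightarrow> c s e \<in> edges G \<and> src (c s e) = s"
  shows "strategy0 G (\<lambda>s \<rho>. c (last_state s \<rho>) (level \<rho>))"
  using assms by (simp add: strategy0_def)

text \<open>Choosing edges that decrease the rank gives a strategy that depends only on the current
  state and energy.\<close>

lemma attr_strategy:
  assumes total: "\<forall>s\<in>states G. \<exists>d\<in>edges G. src d = s"
    and inter: "states0 G \<inter> states1 G = {}"
    and win: "attr G B s (\<lambda>_. 0)"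
  shows "\<exists>\<sigma>. strategy0 G \<sigma> \<and>
    (\<forall>\<pi>\<in>outcomes0 G \<sigma> s. \<exists>n. B (src (\<pi> n)) (level (play_prefix \<pi> n)))"
proof -
  \<comment> \<open>At rank 0 and outside the attractor the implication is vacuous, so every
    outgoing edge is good there.\<close>
  define good where "good = (\<lambda>s e d. d \<in> edges G \<and> src d = s \<and>
    (\<forall>n. attr_rank G B (Suc n) s e \<and> \<not> attr_rank G B n s e \<longrightarrow>
       attr_rank G B n (tgt d) (shift e (wt d))))"
  define c where "c = (\<lambda>s e. SOME d. good s e d)"
  have ex: "\<exists>d. good s e d" if s: "s \<in> states0 G" for s e
  proof (cases "\<exists>n. attr_rank G B (Suc n) s e \<and> \<not> attr_rank G B n s e")
    case True
    then obtain n where n: "attr_rank G B (Suc n) s e" "\<not> attr_rank G B n s e" by blast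
    then obtain d where d: "d \<in> edges G" "src d = s" "attr_rank G B n (tgt d) (shift e (wt d))"
      using s inter by auto
    \<comment> \<open>Ranks are cumulative, so a configuration enters the attractor at a single
      index; the edge chosen for that index therefore serves all \<open>n\<close> in
      \<open>good\<close>.\<close>
    have "m = n" if "attr_rank G B (Suc m) s e" "\<not> attr_rank G B m s e" for m
    proof (rule ccontr)
      assume "m \<noteq> n"
      then consider "Suc m \<le> n" | "Suc n \<le> m" by linarith
      then show False
      proof cases
        case 1
        show ?thesis using attr_rank_mono[OF that(1) 1] n(2) by (rule notE[rotated])
      next
        case 2
        show ?thesis using attr_rank_mono[OF n(1) 2] that(2) by (rule notE[rotated])
      qed
    qed
    then have "good s e d" using d unfolding good_def by blast
    then show ?thesis ..
  next
    case False
    have "s \<in> states G" using s by (simp add: states_def)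
    then obtain d where "d \<in> edges G" "src d = s" using total by blast
    then show ?thesis using False unfolding good_def by blast
  qed
  then have c: "good s e (c s e)" if "s \<in> states0 G" for s e
    unfolding c_def using that by (metis someI_ex)
  define \<sigma> where "\<sigma> = (\<lambda>s \<rho>. c (last_state s \<rho>) (level \<rho>))"
  have "strategy0 G \<sigma>"
    unfolding \<sigma>_def by (rule strategy0_of_choice) (use c in \<open>auto simp: good_def\<close>)
  moreover have "\<exists>n. B (src (\<pi> n)) (level (play_prefix \<pi> n))" if \<pi>: "\<pi> \<in> outcomes0 G \<sigma> s" for \<pi>
  proof -
    have play: "\<pi> \<in> plays G" "src (\<pi> 0) = s" using \<pi> by (auto simp: outcomes0_def)
    have reach: "\<exists>n. B (src (\<pi> n)) (level (play_prefix \<pi> n))"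
      if "attr_rank G B r (src (\<pi> m)) (level (play_prefix \<pi> m))" for r m
      using that
    proof (induction r arbitrary: m)
      case 0
      then show ?case by auto
    next
      case (Suc r)
      let ?s = "src (\<pi> m)" and ?e = "level (play_prefix \<pi> m)"
      have nxt: "src (\<pi> (Suc m)) = tgt (\<pi> m)" "\<pi> m \<in> edges G"
        "level (play_prefix \<pi> (Suc m)) = shift ?e (wt (\<pi> m))"
        using play(1) by (auto simp: plays_def play_prefix_Suc level_snoc)
      show ?case
      proof (cases "attr_rank G B r ?s ?e")
        case True
        then show ?thesis by (rule Suc.IH)
      next
        case False
        have "attr_rank G B r (tgt (\<pi> m)) (shift ?e (wt (\<pi> m)))"
        proof (cases "?s \<in> states0 G")
          case True
          then have "\<pi> m = \<sigma> s (play_prefix \<pi> m)"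
            using \<pi> play_src[OF play] by (simp add: outcomes0_def)
          moreover have "good ?s ?e (\<sigma> s (play_prefix \<pi> m))"
            using c[OF True] by (simp add: \<sigma>_def play_src[OF play])
          ultimately have "good ?s ?e (\<pi> m)" by metis
          then show ?thesis using False Suc.prems unfolding good_def by blast
        next
          case notin: False
          then show ?thesis using False Suc.prems nxt(2) by auto
        qed
        then have "attr_rank G B r (src (\<pi> (Suc m))) (level (play_prefix \<pi> (Suc m)))"
          by (simp only: nxt)
        then show ?thesis by (rule Suc.IH)
      qed
    qed
    from win obtain r where "attr_rank G B r s (\<lambda>_. 0)" by (auto simp: attr_def)
    then show ?thesis using reach[of r 0] play(2) by (simp add: play_prefix_0 level_Nil)
  qed
  ultimately show ?thesis by blast
qed

text \<open>The set \<open>Z\<close> will be the targets of the objections of \<open>P\<^sub>1\<close>: an objection that is not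
  raised on the outcome is one that \<open>P\<^sub>0\<close> could have refuted.\<close>

lemma not_attr_outcome:
  assumes wf: "\<forall>d\<in>edges G. src d \<in> states G \<and> tgt d \<in> states G"
    and fin: "finite (edges G)"
    and \<sigma>: "strategy0 G \<sigma>" and s: "s \<in> states G" and lose: "\<not> attr G B s (\<lambda>_. 0)"
  shows "\<exists>\<pi>\<in>outcomes0 G \<sigma> s. \<forall>n.
    \<not> attr G B (src (\<pi> n)) (level (play_prefix \<pi> n)) \<and>
    (src (\<pi> n) \<in> states1 G - states0 G \<and> tgt (\<pi> n) \<notin> Z \<longrightarrow>
      (\<forall>d\<in>edges G. src d = src (\<pi> n) \<and> tgt d \<in> Z \<longrightarrow>
         attr G B (tgt d) (shift (level (play_prefix \<pi> n)) (wt d))))"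
proof -
  define esc where "esc = (\<lambda>\<rho> d. d \<in> edges G \<and> src d = last_state s \<rho> \<and>
    \<not> attr G B (tgt d) (shift (level \<rho>) (wt d)))"
  \<comment> \<open>The second player stays outside the attractor and, among the edges that do so,
    prefers one into \<open>Z\<close>.\<close>
  define move where "move = (\<lambda>\<rho>. if last_state s \<rho> \<in> states0 G then \<sigma> s \<rho>
    else if \<exists>d. esc \<rho> d \<and> tgt d \<in> Z then SOME d. esc \<rho> d \<and> tgt d \<in> Z
    else SOME d. esc \<rho> d)"
  \<comment> \<open>The strategy may depend on the whole past, so the recursion builds prefixes and
    the play is read off from them.\<close>
  define hist where "hist = rec_nat [] (\<lambda>_ \<rho>. \<rho> @ [move \<rho>])"
  have hist: "hist 0 = []" "\<And>n. hist (Suc n) = hist n @ [move (hist n)]"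
    by (simp_all add: hist_def)
  define \<pi> where "\<pi> = (\<lambda>n. move (hist n))"
  have pre: "play_prefix \<pi> n = hist n" for n
    by (induction n) (simp_all add: play_prefix_0 play_prefix_Suc hist \<pi>_def)
  have move_esc: "esc \<rho> (move \<rho>)"
    if \<rho>: "path_from G s \<rho>" "\<not> attr G B (last_state s \<rho>) (level \<rho>)" for \<rho>
  proof (cases "last_state s \<rho> \<in> states0 G")
    case True
    then have "\<sigma> s \<rho> \<in> edges G" "src (\<sigma> s \<rho>) = last_state s \<rho>"
      using \<sigma> \<rho>(1) by (auto simp: strategy0_def)
    moreover from this have "\<not> attr G B (tgt (\<sigma> s \<rho>)) (shift (level \<rho>) (wt (\<sigma> s \<rho>)))"
      using \<rho>(2) attr_step0[OF True] by metis
    ultimately show ?thesis using True by (simp add: move_def esc_def)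
  next
    case False
    then have "last_state s \<rho> \<in> states1 G"
      using last_state_in_states[OF wf \<rho>(1)] by (auto simp: states_def)
    from attr_step1D[OF \<rho>(2) this fin] have ex: "\<exists>d. esc \<rho> d" by (auto simp: esc_def)
    show ?thesis
    proof (cases "\<exists>d. esc \<rho> d \<and> tgt d \<in> Z")
      case True
      then show ?thesis using False someI_ex[OF True] by (simp add: move_def)
    next
      case noZ: False
      then show ?thesis using False someI_ex[OF ex] by (simp only: move_def if_False)
    qed
  qed
  have inv: "path_from G s (hist n) \<and> \<not> attr G B (last_state s (hist n)) (level (hist n))" for n
  proof (induction n)
    case 0
    then show ?case using s lose by (simp add: hist last_state_def level_Nil)
  next
    case (Suc n)
    then have "esc (hist n) (move (hist n))" using move_esc by blast
    then show ?case using Suc wf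
      by (auto simp: hist path_from_snoc last_state_snoc level_snoc esc_def)
  qed
  have esc: "esc (hist n) (\<pi> n)" for n using move_esc inv by (simp add: \<pi>_def)
  have edge: "\<pi> n \<in> edges G" "src (\<pi> n) = last_state s (hist n)" for n
    using esc[of n] by (auto simp: esc_def)
  have "last_state s (hist (Suc n)) = tgt (\<pi> n)" for n by (simp add: hist last_state_snoc \<pi>_def)
  then have play: "\<pi> \<in> plays G" using edge by (auto simp: plays_def)
  have "src (\<pi> 0) = s" using edge by (simp add: hist last_state_def)
  moreover have "\<pi> n = \<sigma> s (hist n)" if "last_state s (hist n) \<in> states0 G" for n
    using that unfolding \<pi>_def move_def by (rule if_P)
  ultimately have out: "\<pi> \<in> outcomes0 G \<sigma> s"
    using play unfolding outcomes0_def mem_Collect_eq pre by blast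
  have pref: "attr G B (tgt d) (shift (level (hist n)) (wt d))"
    if "src (\<pi> n) \<notin> states0 G" "tgt (\<pi> n) \<notin> Z" "d \<in> edges G" "src d = src (\<pi> n)" "tgt d \<in> Z"
    for n d
  proof (rule ccontr)
    assume "\<not> ?thesis"
    then have "esc (hist n) d" using that(3,4) edge(2) by (simp add: esc_def)
    then have ex: "\<exists>d. esc (hist n) d \<and> tgt d \<in> Z" using that(5) by blast
    moreover have "last_state s (hist n) \<notin> states0 G" using that(1) edge(2) by simp
    ultimately have "\<pi> n = (SOME d. esc (hist n) d \<and> tgt d \<in> Z)"
      unfolding \<pi>_def move_def by simp
    then show False using someI_ex[OF ex] that(2) by simp
  qed
  show ?thesis
    unfolding edge(2)[symmetric] pre
    using inv pref by (intro bexI[OF _ out] allI) (metis DiffD2 edge(2) pre)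
qed

subsection \<open>Limits of average energies\<close>

lemma average_energy_play_prefix:
  "average_energy i (play_prefix \<pi> n) =
     (\<Sum>j=1..n. real_of_int (energy_level i (play_prefix \<pi> j))) / real n"
proof -
  have "take j (play_prefix \<pi> n) = play_prefix \<pi> j" if "j \<le> n" for j
    using that by (simp add: play_prefix_def take_map)
  then show ?thesis
    by (auto simp: average_energy_def play_prefix_def intro!: arg_cong2[of _ _ _ _ "(/)"] sum.cong)
qed

text \<open>The levels before \<open>M\<close> contribute at most a constant \<open>C\<close> to the
  sums and the later ones nothing positive, so the averages are bounded by
  \<open>C / n\<close>.\<close>

lemma limsup_average_energy_le_0:
  assumes "\<And>m. m \<ge> M \<Longrightarrow> energy_level i (play_prefix \<pi> m) \<le> 0"
  shows "limsup_average_energy i \<pi> \<le> 0"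
proof -
  let ?f = "\<lambda>j. real_of_int (energy_level i (play_prefix \<pi> j))"
  define C where "C = (\<Sum>j<M. \<bar>?f j\<bar>)"
  have bound: "average_energy i (play_prefix \<pi> n) \<le> C / real n" for n
  proof -
    have "(\<Sum>j=1..n. ?f j) \<le> (\<Sum>j=1..n. if j < M then \<bar>?f j\<bar> else 0)"
      using assms by (intro sum_mono) (auto simp: not_less)
    also have "\<dots> = (\<Sum>j\<in>{1..n} \<inter> {j. j < M}. \<bar>?f j\<bar>)"
      by (rule sum.inter_restrict[symmetric, where B="{j. j < M}", simplified mem_Collect_eq]) simp
    also have "\<dots> \<le> C" unfolding C_def by (rule sum_mono2) auto
    finally show ?thesis by (simp add: average_energy_play_prefix divide_right_mono)
  qed
  have "(\<lambda>n. C / real n) \<longlonglongrightarrow> 0" by (rule lim_const_over_n)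
  then have "(\<lambda>n. ereal (C / real n)) \<longlonglongrightarrow> ereal 0" by (rule tendsto_ereal)
  then have "limsup (\<lambda>n. ereal (C / real n)) = 0"
    by (simp add: lim_imp_Limsup zero_ereal_def)
  moreover have "limsup_average_energy i \<pi> \<le> limsup (\<lambda>n. ereal (C / real n))"
    unfolding limsup_average_energy_def by (intro Limsup_mono always_eventually) (simp add: bound)
  ultimately show ?thesis by simp
qed

text \<open>The deficits of the levels below 1 are nonpositive from \<open>M\<close> on, so their
  sums are bounded by a constant \<open>C\<close> and the averages are at least
  \<open>1 - C / n\<close>.\<close>

lemma limsup_average_energy_ge_1:
  assumes "\<And>m. m \<ge> M \<Longrightarrow> energy_level i (play_prefix \<pi> m) \<ge> 1"
  shows "limsup_average_energy i \<pi> \<ge> 1"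
proof -
  let ?f = "\<lambda>j. real_of_int (energy_level i (play_prefix \<pi> j))"
  define C where "C = (\<Sum>j<M. 1 + \<bar>?f j\<bar>)"
  have bound: "average_energy i (play_prefix \<pi> n) \<ge> 1 - C / real n" if "n > 0" for n
  proof -
    have "(\<Sum>j=1..n. 1 - ?f j) \<le> (\<Sum>j=1..n. if j < M then 1 + \<bar>?f j\<bar> else 0)"
      using assms by (intro sum_mono) (auto simp: not_less)
    also have "\<dots> = (\<Sum>j\<in>{1..n} \<inter> {j. j < M}. 1 + \<bar>?f j\<bar>)"
      by (rule sum.inter_restrict[symmetric, where B="{j. j < M}", simplified mem_Collect_eq]) simp
    also have "\<dots> \<le> C" unfolding C_def by (rule sum_mono2) auto
    finally have "real n - C \<le> (\<Sum>j=1..n. ?f j)" by (simp add: sum_subtractf)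
    then have "(real n - C) / real n \<le> average_energy i (play_prefix \<pi> n)"
      by (simp add: average_energy_play_prefix divide_right_mono)
    then show ?thesis using that by (simp add: diff_divide_distrib)
  qed
  have "(\<lambda>n. 1 - C / real n) \<longlonglongrightarrow> 1 - 0" by (intro tendsto_intros lim_const_over_n)
  then have "(\<lambda>n. ereal (1 - C / real n)) \<longlonglongrightarrow> ereal 1" by (intro tendsto_ereal) simp
  then have "limsup (\<lambda>n. ereal (1 - C / real n)) = 1"
    by (simp add: lim_imp_Limsup one_ereal_def)
  moreover have "limsup (\<lambda>n. ereal (1 - C / real n)) \<le> limsup_average_energy i \<pi>"
    unfolding limsup_average_energy_def
    by (intro Limsup_mono eventually_mono[OF eventually_gt_at_top[of 0]]) (simp add: bound)
  ultimately show ?thesis by (rule ord_eq_le_trans[OF sym])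
qed

section \<open>Alternating machines operating on a number\<close>

datatype 'q instr = Update nat nat "nat list" 'q | Choice0 "'q list" | Choice1 "'q list"

text \<open>Updates comprise multiplication by \<open>p\<close> (\<open>Update 1 p [0]\<close>), exact division by \<open>p\<close>
  (\<open>Update p 1 [0]\<close>) and the test for indivisibility by \<open>p\<close> (\<open>Update p p [1..<p]\<close>).\<close>

inductive acc :: "('q \<Rightarrow> 'q instr) \<Rightarrow> 'q \<Rightarrow> nat \<Rightarrow> bool" for \<delta> where
  acc_Update: "\<delta> q = Update c d R q' \<Longrightarrow> r \<in> set R \<Longrightarrow> acc \<delta> q' (d * j + r) \<Longrightarrow>
    acc \<delta> q (c * j + r)"
| acc_Choice0: "\<delta> q = Choice0 qs \<Longrightarrow> q' \<in> set qs \<Longrightarrow> acc \<delta> q' n \<Longrightarrow> acc \<delta> q n"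
| acc_Choice1: "\<delta> q = Choice1 qs \<Longrightarrow> (\<And>q'. q' \<in> set qs \<Longrightarrow> acc \<delta> q' n) \<Longrightarrow> acc \<delta> q n"

lemma acc_iff:
  "acc \<delta> q n \<longleftrightarrow> (case \<delta> q of
     Update c d R q' \<Rightarrow> \<exists>j. \<exists>r\<in>set R. n = c * j + r \<and> acc \<delta> q' (d * j + r)
   | Choice0 qs \<Rightarrow> \<exists>q'\<in>set qs. acc \<delta> q' n
   | Choice1 qs \<Rightarrow> \<forall>q'\<in>set qs. acc \<delta> q' n)"
proof
  assume "acc \<delta> q n"
  then show "case \<delta> q of
     Update c d R q' \<Rightarrow> \<exists>j. \<exists>r\<in>set R. n = c * j + r \<and> acc \<delta> q' (d * j + r)
   | Choice0 qs \<Rightarrow> \<exists>q'\<in>set qs. acc \<delta> q' n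
   | Choice1 qs \<Rightarrow> \<forall>q'\<in>set qs. acc \<delta> q' n"
    by cases auto
qed (auto split: instr.splits intro: acc.intros)

section \<open>From machines to games\<close>

text \<open>A number \<open>a\<close> is kept in one of two counters, \<open>s\<close> telling in which one; the value of the
  other counter is \<open>b\<close>. The three energy levels are \<open>a + 1\<close>, \<open>b + 1\<close> (exchanged if \<open>\<not> s\<close>) and
  \<open>- (a + b) - 1\<close>. An update is performed by \<open>P\<^sub>0\<close> moving the number to the other counter step
  by step. After each step, in \<open>Over\<close>, and at the end, in \<open>Exit\<close>, \<open>P\<^sub>1\<close> may object that \<open>a\<close> is
  negative, or at the end that it is positive. As an upper bound on the third level bounds only
  \<open>a + b\<close> from below, an objection to a negative \<open>a\<close> leads to \<open>Drain\<close>, where \<open>P\<^sub>1\<close> lowers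
  \<open>b\<close> to \<open>0\<close>; in \<open>Stop\<close>, \<open>P\<^sub>0\<close> wins if \<open>b\<close> has become negative.\<close>

datatype 'q st =
    Init
  | Sink nat
  | Ctl 'q bool
  | Over 'q bool
  | Exit 'q bool
  | Drain bool
  | Stop bool

instance st :: (countable) countable by countable_datatype

definition own :: "bool \<Rightarrow> nat" where
  "own s = (if s then 0 else 1)"

text \<open>The three entries add up to 0. Moving the counters thus keeps the sum of the three
  levels at 1, which ties the third level to \<open>a + b\<close>.\<close>

definition mv :: "bool \<Rightarrow> int \<Rightarrow> int \<Rightarrow> int list" where
  "mv s x y = (if s then [x, y, - x - y] else [y, x, - x - y])"

text \<open>The loop freezes level \<open>i\<close> and lowers the two others without bound, so only
  level \<open>i\<close> can keep an average above 0.\<close>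

definition sink_weight :: "nat \<Rightarrow> int list" where
  "sink_weight i = map (\<lambda>j. if j = i then 0 else - 1) [0..<3]"

text \<open>The loop at a \<open>Choice0\<close> and the edge to \<open>Sink 2\<close> at a
  \<open>Choice1\<close> provide an outgoing edge even if the list is empty. Looping forever keeps
  the first level positive, and the edge to \<open>Sink 2\<close> is won by the first player as long
  as \<open>a + b\<close> is nonnegative, so neither changes who wins. The weight on the way from
  \<open>Exit\<close> to a sink turns the test into \<open>a \<le> 0\<close>, the one from
  \<open>Drain\<close> into \<open>a + b \<ge> 0\<close>.\<close>

fun moves :: "('q \<Rightarrow> 'q instr) \<Rightarrow> 'q st \<Rightarrow> (int list \<times> 'q st) list" where
  "moves \<delta> Init = []"
| "moves \<delta> (Sink i) = [(sink_weight i, Sink i)]"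
| "moves \<delta> (Ctl q s) = (case \<delta> q of
     Update c d R q' \<Rightarrow> (mv s (- int c) (int d), Over q s) #
       map (\<lambda>r. (mv s (- int r) (int r), Exit q s)) R
   | Choice0 qs \<Rightarrow> (mv s 0 0, Ctl q s) # map (\<lambda>q'. (mv s 0 0, Ctl q' s)) qs
   | Choice1 qs \<Rightarrow> ([0, 0, 1], Sink 2) # map (\<lambda>q'. (mv s 0 0, Ctl q' s)) qs)"
| "moves \<delta> (Over q s) = [(mv s 0 0, Ctl q s), (mv s 0 0, Drain s)]"
| "moves \<delta> (Exit q s) = (if s then [- 1, 0, 0] else [0, - 1, 0], Sink (own s)) #
     (mv s 0 0, Drain s) #
     (case \<delta> q of Update c d R q' \<Rightarrow> [(mv s 0 0, Ctl q' (\<not> s))] | _ \<Rightarrow> [])"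
| "moves \<delta> (Drain s) = [([0, 0, 1], Sink 2), (mv s 0 (- 1), Stop s)]"
| "moves \<delta> (Stop s) = [(mv s 0 0, Drain s), (mv s 0 0, Sink (own (\<not> s)))]"

fun owner0 :: "('q \<Rightarrow> 'q instr) \<Rightarrow> 'q st \<Rightarrow> bool" where
  "owner0 \<delta> (Ctl q s) \<longleftrightarrow> (case \<delta> q of Choice1 _ \<Rightarrow> False | _ \<Rightarrow> True)"
| "owner0 \<delta> (Over q s) \<longleftrightarrow> False"
| "owner0 \<delta> (Exit q s) \<longleftrightarrow> False"
| "owner0 \<delta> (Drain s) \<longleftrightarrow> False"
| "owner0 \<delta> _ \<longleftrightarrow> True"

definition st_set :: "'q set \<Rightarrow> 'q st set" where
  "st_set Q = insert Init (Sink ` {0, 1, 2} \<union> (\<Union>s. insert (Drain s) (insert (Stop s)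
     ((\<lambda>q. Ctl q s) ` Q \<union> (\<lambda>q. Over q s) ` Q \<union> (\<lambda>q. Exit q s) ` Q))))"

definition pad :: "nat \<Rightarrow> int list \<Rightarrow> int list" where
  "pad k w = w @ replicate (k - 3) 0"

text \<open>The initial edge is left out so that this set does not depend on the start number, which
  will later be computed from the code of this set.\<close>

definition base_edges :: "nat \<Rightarrow> ('q st \<Rightarrow> nat) \<Rightarrow> ('q \<Rightarrow> 'q instr) \<Rightarrow> 'q set \<Rightarrow> nat edge set" where
  "base_edges k h \<delta> Q = (\<Union>x\<in>st_set Q. (\<lambda>(w, y). (h x, pad k w, h y)) ` set (moves \<delta> x))"

definition init_weight :: "nat \<Rightarrow> int list" where
  "init_weight n = [int n + 1, 1, - int n - 1]"

definition sim_game ::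
  "nat \<Rightarrow> ('q st \<Rightarrow> nat) \<Rightarrow> ('q \<Rightarrow> 'q instr) \<Rightarrow> 'q set \<Rightarrow> 'q \<Rightarrow> nat \<Rightarrow> nat game" where
  "sim_game k h \<delta> Q q0 n = \<lparr>
     states0 = h ` {x\<in>st_set Q. owner0 \<delta> x}, states1 = h ` {x\<in>st_set Q. \<not> owner0 \<delta> x},
     edges = insert (h Init, pad k (init_weight n), h (Ctl q0 True)) (base_edges k h \<delta> Q)\<rparr>"

locale simulation =
  fixes \<delta> :: "'q \<Rightarrow> 'q instr" and Q :: "'q set" and q0 :: 'q and n k :: nat
    and h :: "'q st \<Rightarrow> nat"
  assumes finite_Q: "finite Q" and q0: "q0 \<in> Q"
    and closed: "\<And>q. q \<in> Q \<Longrightarrow> set_instr (\<delta> q) \<subseteq> Q"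
    and k: "3 \<le> k" and inj_h: "inj h"
begin

abbreviation "G \<equiv> sim_game k h \<delta> Q q0 n"

abbreviation "S \<equiv> st_set Q"

definition succs :: "'q st \<Rightarrow> (int list \<times> 'q st) list" where
  "succs x = (if x = Init then [(init_weight n, Ctl q0 True)] else moves \<delta> x)"

lemma h_eq_iff [simp]: "h x = h y \<longleftrightarrow> x = y"
  using inj_h by (rule inj_eq)

lemma finite_S: "finite S"
  using finite_Q by (simp add: st_set_def)

lemma st_set_simps [simp]:
  "Init \<in> S" "Sink i \<in> S \<longleftrightarrow> i < 3" "Ctl q s \<in> S \<longleftrightarrow> q \<in> Q" "Over q s \<in> S \<longleftrightarrow> q \<in> Q"
  "Exit q s \<in> S \<longleftrightarrow> q \<in> Q" "Drain s \<in> S" "Stop s \<in> S"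
  by (auto simp: st_set_def)

lemma succs_simps [simp]:
  "succs Init = [(init_weight n, Ctl q0 True)]" "succs (Sink i) = moves \<delta> (Sink i)"
  "succs (Ctl q s) = moves \<delta> (Ctl q s)" "succs (Over q s) = moves \<delta> (Over q s)"
  "succs (Exit q s) = moves \<delta> (Exit q s)" "succs (Drain s) = moves \<delta> (Drain s)"
  "succs (Stop s) = moves \<delta> (Stop s)"
  by (simp_all add: succs_def)

lemma closed_Update: "\<delta> q = Update c d R q' \<Longrightarrow> q \<in> Q \<Longrightarrow> q' \<in> Q"
  using closed[of q] by simp

lemma closed_Choice:
  "\<delta> q = Choice0 qs \<Longrightarrow> q \<in> Q \<Longrightarrow> q' \<in> set qs \<Longrightarrow> q' \<in> Q"
  "\<delta> q = Choice1 qs \<Longrightarrow> q \<in> Q \<Longrightarrow> q' \<in> set qs \<Longrightarrow> q' \<in> Q"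
  using closed[of q] by auto

lemma succs_in_S: "x \<in> S \<Longrightarrow> (w, y) \<in> set (succs x) \<Longrightarrow> y \<in> S"
  using q0
  by (cases x)
    (auto simp: own_def split: instr.splits if_splits
      intro: closed_Update closed_Update[OF sym] closed_Choice)

lemma length_succs: "(w, y) \<in> set (succs x) \<Longrightarrow> length w = 3"
  by (cases x) (auto simp: init_weight_def sink_weight_def mv_def split: instr.splits if_splits)

lemma succs_nonempty: "succs x \<noteq> []"
  by (cases x) (auto split: instr.splits)

lemma edges_G: "edges G = {(h x, pad k w, h y) | x w y. x \<in> S \<and> (w, y) \<in> set (succs x)}"
  by (auto simp: sim_game_def base_edges_def succs_def split: if_splits) (metis moves.simps(1) empty_iff list.set(1))+

lemma states_G [simp]:
  "h x \<in> states0 G \<longleftrightarrow> x \<in> S \<and> owner0 \<delta> x" "h x \<in> states1 G \<longleftrightarrow> x \<in> S \<and> \<not> owner0 \<delta> x"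
  "h x \<in> states G \<longleftrightarrow> x \<in> S"
  by (auto simp: sim_game_def states_def)

lemma states_G_eq: "states G = h ` S"
  by (auto simp: sim_game_def states_def)

lemma finite_edges_G: "finite (edges G)"
  using finite_S by (auto simp: sim_game_def base_edges_def)

lemma edges_G_states: "\<forall>d\<in>edges G. src d \<in> states G \<and> tgt d \<in> states G"
  unfolding edges_G by (auto simp: src_def tgt_def succs_in_S)

lemma edges_G_total: "\<forall>s\<in>states G. \<exists>d\<in>edges G. src d = s"
proof
  fix s assume "s \<in> states G"
  then obtain x where x: "s = h x" "x \<in> S" by (auto simp: states_G_eq)
  obtain w y where "(w, y) \<in> set (succs x)"
    using succs_nonempty[of x] by (metis list.set_intros(1) neq_Nil_conv surj_pair)
  then have "(h x, pad k w, h y) \<in> edges G" using x by (auto simp: edges_G)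
  then show "\<exists>d\<in>edges G. src d = s" using x by (auto simp: src_def intro!: bexI)
qed

lemma disjoint_G: "states0 G \<inter> states1 G = {}"
  by (auto simp: sim_game_def)

lemma weighted_game_G: "weighted_game k G"
proof -
  define W where "W = (\<Sum>d\<in>edges G. \<Sum>i\<leftarrow>wt d. nat \<bar>i\<bar>)"
  have "nat \<bar>i\<bar> \<le> W" if "d \<in> edges G" "i \<in> set (wt d)" for d i
  proof -
    have "nat \<bar>i\<bar> \<le> (\<Sum>i\<leftarrow>wt d. nat \<bar>i\<bar>)" using that(2) by (intro member_le_sum_list) auto
    also have "\<dots> \<le> W" unfolding W_def
      using finite_edges_G that(1) by (intro member_le_sum[where f="\<lambda>d. \<Sum>i\<leftarrow>wt d. nat \<bar>i\<bar>"]) auto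
    finally show ?thesis .
  qed
  then have W: "set (wt d) \<subseteq> {- int W..int W}" if "d \<in> edges G" for d
    using that by (fastforce simp: abs_le_iff nat_le_iff)
  have len: "length (wt d) = k" if "d \<in> edges G" for d
    using that k length_succs by (auto simp: edges_G wt_def pad_def)
  have "edges G \<subseteq> states G \<times> {w. length w = k \<and> set w \<subseteq> {- int W..int W}} \<times> states G"
  proof
    fix d assume d: "d \<in> edges G"
    have "d = (src d, wt d, tgt d)" by (simp add: src_def wt_def tgt_def)
    then show "d \<in> states G \<times> {w. length w = k \<and> set w \<subseteq> {- int W..int W}} \<times> states G"
      using W[OF d] len[OF d] edges_G_states d by (metis (mono_tags, lifting) mem_Collect_eq SigmaI)
  qed
  moreover have "finite (states0 G)" "finite (states1 G)" using finite_S by (auto simp: sim_game_def)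
  ultimately show ?thesis
    unfolding weighted_game_def using disjoint_G finite_edges_G edges_G_total by blast
qed

section \<open>The winning region as an attractor of sinks with nonpositive level\<close>

definition base :: "nat \<Rightarrow> (nat \<Rightarrow> int) \<Rightarrow> bool" where
  "base s e \<longleftrightarrow> (\<exists>i<3. s = h (Sink i) \<and> e i \<le> 0)"

definition win :: "'q st \<Rightarrow> (nat \<Rightarrow> int) \<Rightarrow> bool" where
  "win x e \<longleftrightarrow> attr G base (h x) e"

lemma win_Sink: "i < 3 \<Longrightarrow> e i \<le> 0 \<Longrightarrow> win (Sink i) e"
  unfolding win_def by (rule attr_base) (auto simp: base_def)

lemma win_step0:
  assumes "x \<in> S" "owner0 \<delta> x" "(w, y) \<in> set (succs x)" "win y (shift e (pad k w))"
  shows "win x e"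
proof -
  have "(h x, pad k w, h y) \<in> edges G" using assms(1,3) by (auto simp: edges_G)
  then show ?thesis unfolding win_def
    by (rule attr_step0[rotated]) (use assms in \<open>simp_all add: win_def src_def wt_def tgt_def\<close>)
qed

lemma win_step1:
  assumes "x \<in> S" "\<not> owner0 \<delta> x"
    and "\<And>w y. (w, y) \<in> set (succs x) \<Longrightarrow> win y (shift e (pad k w))"
  shows "win x e"
  unfolding win_def
proof (rule attr_step1)
  fix d assume "d \<in> edges G" "src d = h x"
  then show "attr G base (tgt d) (shift e (wt d))"
    using assms(3) by (auto simp: edges_G src_def wt_def tgt_def win_def)
qed (use assms finite_edges_G in simp_all)

text \<open>Induction on the rank, transferred from numbers to the states they name: the winning
  region is the least set closed under these rules.\<close>

lemma win_induct [consumes 2, case_names Sink step0 step1]: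
  assumes "win x e" "x \<in> S"
    and Sink: "\<And>i e. i < 3 \<Longrightarrow> e i \<le> 0 \<Longrightarrow> P (Sink i) e"
    and step0: "\<And>x w y e. x \<in> S \<Longrightarrow> owner0 \<delta> x \<Longrightarrow> (w, y) \<in> set (succs x) \<Longrightarrow>
      P y (shift e (pad k w)) \<Longrightarrow> P x e"
    and step1: "\<And>x e. x \<in> S \<Longrightarrow> \<not> owner0 \<delta> x \<Longrightarrow>
      (\<And>w y. (w, y) \<in> set (succs x) \<Longrightarrow> P y (shift e (pad k w))) \<Longrightarrow> P x e"
  shows "P x e"
proof -
  have "P x e" if "attr_rank G base r (h x) e" "x \<in> S" for r x e
    using that
  proof (induction r arbitrary: x e)
    case 0
    then show ?case using Sink by (auto simp: base_def)
  next
    case (Suc r)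
    from Suc.prems(1) consider "attr_rank G base r (h x) e"
      | d where "owner0 \<delta> x" "d \<in> edges G" "src d = h x" "attr_rank G base r (tgt d) (shift e (wt d))"
      | "\<not> owner0 \<delta> x" "\<forall>d\<in>edges G. src d = h x \<longrightarrow> attr_rank G base r (tgt d) (shift e (wt d))"
      by auto
    then show ?case
    proof cases
      case 1
      then show ?thesis using Suc by blast
    next
      case 2
      then obtain w y where y: "d = (h x, pad k w, h y)" "(w, y) \<in> set (succs x)"
        by (auto simp: edges_G src_def)
      have "P y (shift e (pad k w))"
        using 2(4) succs_in_S[OF Suc.prems(2) y(2)] by (intro Suc.IH) (simp_all add: y tgt_def wt_def)
      then show ?thesis using step0 Suc.prems(2) 2(1) y(2) by blast
    next
      case 3
      have "P y (shift e (pad k w))" if y: "(w, y) \<in> set (succs x)" for w y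
      proof -
        have "(h x, pad k w, h y) \<in> edges G" using y Suc.prems(2) by (auto simp: edges_G)
        then have "attr_rank G base r (h y) (shift e (pad k w))"
          using 3(2) by (auto simp: src_def tgt_def wt_def dest!: bspec)
        then show ?thesis using Suc.IH succs_in_S[OF Suc.prems(2) y] by blast
      qed
      then show ?thesis using step1 Suc.prems(2) 3(1) by blast
    qed
  qed
  then show ?thesis using assms(1,2) by (auto simp: win_def attr_def)
qed

text \<open>The counters are integers, so that the outcome of an incorrect move is described as
  well.\<close>

definition cfg :: "bool \<Rightarrow> int \<Rightarrow> int \<Rightarrow> (nat \<Rightarrow> int) \<Rightarrow> bool" where
  "cfg s a b e \<longleftrightarrow> e (own s) = a + 1 \<and> e (own (\<not> s)) = b + 1 \<and> e 2 = - a - b - 1"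

lemma shift_pad: "length w = 3 \<Longrightarrow> i < 3 \<Longrightarrow> shift e (pad k w) i = e i + w ! i"
  by (simp add: shift_def pad_def nth_append)

lemma shift_pad3:
  "shift e (pad k [x, y, z]) 0 = e 0 + x" "shift e (pad k [x, y, z]) (Suc 0) = e (Suc 0) + y"
  "shift e (pad k [x, y, z]) 2 = e 2 + z"
  by (simp_all add: shift_pad numeral_2_eq_2)

lemma cfg_mv: "cfg s a b e \<Longrightarrow> cfg s (a + x) (b + y) (shift e (pad k (mv s x y)))"
  by (auto simp: cfg_def own_def mv_def shift_pad3)

lemma cfg_mv0: "cfg s a b e \<Longrightarrow> cfg s a b (shift e (pad k (mv s 0 0)))"
  using cfg_mv[of s a b e 0 0] by simp

lemma cfg_swap: "cfg (\<not> s) b a e \<longleftrightarrow> cfg s a b e"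
  by (auto simp: cfg_def)

subsection \<open>Accepted numbers are won by the first player\<close>

text \<open>While both counters are nonnegative, the edge to \<open>Sink 2\<close> is entered with
  third level \<open>- (a + b)\<close>. If the second player lowers \<open>b\<close> instead, the
  first player returns to \<open>Drain\<close> until \<open>b\<close> is \<open>- 1\<close>; then
  the level of that counter is 0 and its sink is won.\<close>

lemma win_Drain: "a \<ge> 0 \<Longrightarrow> cfg s a (int b) e \<Longrightarrow> win (Drain s) e"
proof (induction b arbitrary: e)
  case 0
  have stop: "win (Stop s) (shift e (pad k (mv s 0 (- 1))))" (is "win _ ?e")
  proof (rule win_step0)
    show "(mv s 0 0, Sink (own (\<not> s))) \<in> set (succs (Stop s))" by simp
    have "cfg s a (- 1) (shift ?e (pad k (mv s 0 0)))" using cfg_mv[OF 0(2), of 0 "- 1"] cfg_mv0 by simp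
    then show "win (Sink (own (\<not> s))) (shift ?e (pad k (mv s 0 0)))"
      by (intro win_Sink) (auto simp: cfg_def own_def)
  qed simp_all
  show ?case
    by (rule win_step1) (use 0 stop in \<open>auto simp: cfg_def shift_pad3 intro!: win_Sink\<close>)
next
  case (Suc b)
  have stop: "win (Stop s) (shift e (pad k (mv s 0 (- 1))))" (is "win _ ?e")
  proof (rule win_step0)
    show "(mv s 0 0, Drain s) \<in> set (succs (Stop s))" by simp
    have "cfg s a (int b) (shift ?e (pad k (mv s 0 0)))"
      using cfg_mv[OF Suc.prems(2), of 0 "- 1"] cfg_mv0 by simp
    then show "win (Drain s) (shift ?e (pad k (mv s 0 0)))" by (rule Suc.IH[OF Suc.prems(1)])
  qed simp_all
  show ?case
    by (rule win_step1) (use Suc.prems stop in \<open>auto simp: cfg_def shift_pad3 intro!: win_Sink\<close>)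
qed

text \<open>Induction on the number \<open>j\<close> of blocks still to be moved; \<open>b\<close>
  accumulates what has been moved, and \<open>m\<close> is the number present in the other counter
  at the end. Objections fail because \<open>a\<close> is never negative and is 0 at
  \<open>Exit\<close>.\<close>

lemma win_Ctl_Update:
  assumes q: "\<delta> q = Update c d R q'" "q \<in> Q" "r \<in> set R"
    and IH: "\<And>e. cfg (\<not> s) (int m) 0 e \<Longrightarrow> win (Ctl q' (\<not> s)) e"
  shows "cfg s (int (c * j + r)) (int b) e \<Longrightarrow> m = b + d * j + r \<Longrightarrow> win (Ctl q s) e"
proof (induction j arbitrary: b e)
  case 0
  have exit: "win (Exit q s) e'" if e': "cfg s 0 (int m) e'" for e'
  proof (rule win_step1)
    fix w y assume "(w, y) \<in> set (succs (Exit q s))"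
    then consider "w = (if s then [- 1, 0, 0] else [0, - 1, 0])" "y = Sink (own s)"
      | "w = mv s 0 0" "y = Drain s" | "w = mv s 0 0" "y = Ctl q' (\<not> s)"
      using q(1) by auto
    then show "win y (shift e' (pad k w))"
    proof cases
      case 1
      then show ?thesis using e' by (auto simp: cfg_def own_def shift_pad3 intro!: win_Sink)
    next
      case 2
      then show ?thesis using win_Drain[OF _ cfg_mv0[OF e']] by simp
    next
      case 3
      then show ?thesis using IH cfg_mv0[OF e'] cfg_swap by blast
    qed
  qed (use q in simp_all)
  show ?case
  proof (rule win_step0)
    show "(mv s (- int r) (int r), Exit q s) \<in> set (succs (Ctl q s))" using q by simp
    show "win (Exit q s) (shift e (pad k (mv s (- int r) (int r))))"
      using cfg_mv[OF 0(1), of "- int r" "int r"] 0(2) by (intro exit) simp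
  qed (use q in simp_all)
next
  case (Suc j)
  let ?e = "shift e (pad k (mv s (- int c) (int d)))"
  have e: "cfg s (int (c * j + r)) (int (b + d)) ?e"
    using cfg_mv[OF Suc.prems(1), of "- int c" "int d"] by (simp add: algebra_simps)
  show ?case
  proof (rule win_step0)
    show "(mv s (- int c) (int d), Over q s) \<in> set (succs (Ctl q s))" using q by simp
    show "win (Over q s) ?e"
    proof (rule win_step1)
      fix w y assume "(w, y) \<in> set (succs (Over q s))"
      then have "w = mv s 0 0" "y = Ctl q s \<or> y = Drain s" by auto
      then show "win y (shift ?e (pad k w))"
        using Suc.IH[OF cfg_mv0[OF e]] Suc.prems(2) win_Drain[OF _ cfg_mv0[OF e]]
        by (auto simp: algebra_simps)
    qed (use q in simp_all)
  qed (use q in simp_all)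
qed

lemma acc_win_Ctl: "acc \<delta> q m \<Longrightarrow> q \<in> Q \<Longrightarrow> cfg s (int m) 0 e \<Longrightarrow> win (Ctl q s) e"
proof (induction arbitrary: s e rule: acc.induct)
  case (acc_Update q c d R q' r j)
  have "q' \<in> Q" using closed_Update acc_Update.hyps(1) acc_Update.prems(1) by blast
  then show ?case
    using acc_Update.prems acc_Update.IH
    by (intro win_Ctl_Update[OF acc_Update.hyps(1) acc_Update.prems(1) acc_Update.hyps(2),
          where b=0 and m="d * j + r" and j=j]) simp_all
next
  case (acc_Choice0 q qs q' m)
  have q': "q' \<in> Q" using closed_Choice(1) acc_Choice0.hyps acc_Choice0.prems(1) by blast
  show ?case
  proof (rule win_step0)
    show "(mv s 0 0, Ctl q' s) \<in> set (succs (Ctl q s))" using acc_Choice0.hyps by simp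
    show "win (Ctl q' s) (shift e (pad k (mv s 0 0)))"
      by (rule acc_Choice0.IH[OF q' cfg_mv0[OF acc_Choice0.prems(2)]])
  qed (use acc_Choice0 in simp_all)
next
  case (acc_Choice1 q qs m)
  show ?case
  proof (rule win_step1)
    fix w y assume "(w, y) \<in> set (succs (Ctl q s))"
    then consider "w = [0, 0, 1]" "y = Sink 2" | q' where "w = mv s 0 0" "y = Ctl q' s" "q' \<in> set qs"
      using acc_Choice1.hyps by auto
    then show "win y (shift e (pad k w))"
    proof cases
      case 1
      \<comment> \<open>The sink is entered with third level \<open>- m\<close>.\<close>
      then show ?thesis using acc_Choice1.prems(2) by (auto simp: cfg_def shift_pad3 intro!: win_Sink)
    next
      case 2
      then have "q' \<in> Q" using closed_Choice(2) acc_Choice1.hyps acc_Choice1.prems(1) by blast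
      then show ?thesis
        unfolding 2 by (rule acc_Choice1.IH[OF 2(3) _ cfg_mv0[OF acc_Choice1.prems(2)]])
    qed
  qed (use acc_Choice1 in simp_all)
qed

subsection \<open>Numbers won by the first player are accepted\<close>

text \<open>An invariant of the winning region, strong enough to give acceptance at
  \<open>Init\<close>. Only nonnegative \<open>b\<close> is constrained, since a negative
  \<open>b\<close> lets the first player win in \<open>Stop\<close>. During an update
  \<open>b\<close> is the part moved so far, and \<open>j\<close> and \<open>r\<close> describe what
  is still to be moved.\<close>

fun good :: "'q st \<Rightarrow> (nat \<Rightarrow> int) \<Rightarrow> bool" where
  "good Init e \<longleftrightarrow> (e = (\<lambda>_. 0) \<longrightarrow> acc \<delta> q0 n)"
| "good (Sink i) e \<longleftrightarrow> e i \<le> 0"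
| "good (Ctl q s) e \<longleftrightarrow> (\<forall>a b. cfg s (int a) (int b) e \<longrightarrow> (case \<delta> q of
     Update c d R q' \<Rightarrow> \<exists>j. \<exists>r\<in>set R. a = c * j + r \<and> acc \<delta> q' (b + d * j + r)
   | _ \<Rightarrow> b = 0 \<longrightarrow> acc \<delta> q a))"
| "good (Over q s) e \<longleftrightarrow> (\<forall>a b. cfg s a (int b) e \<longrightarrow> a \<ge> 0 \<and> (case \<delta> q of
     Update c d R q' \<Rightarrow> \<exists>j. \<exists>r\<in>set R. a = int (c * j + r) \<and> acc \<delta> q' (b + d * j + r)
   | _ \<Rightarrow> True))"
| "good (Exit q s) e \<longleftrightarrow> (\<forall>a b. cfg s a (int b) e \<longrightarrow> a = 0 \<and> (case \<delta> q of
     Update c d R q' \<Rightarrow> acc \<delta> q' b | _ \<Rightarrow> True))"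
| "good (Drain s) e \<longleftrightarrow> (\<forall>a b. cfg s a (int b) e \<longrightarrow> a \<ge> 0)"
| "good (Stop s) e \<longleftrightarrow> (\<forall>a b. cfg s a (int b) e \<longrightarrow> a \<ge> 0)"

lemma good_CtlD: "good (Ctl q s) e \<Longrightarrow> cfg s (int a) 0 e \<Longrightarrow> acc \<delta> q a"
proof -
  assume "good (Ctl q s) e" "cfg s (int a) 0 e"
  then have "case \<delta> q of
       Update c d R q' \<Rightarrow> \<exists>j. \<exists>r\<in>set R. a = c * j + r \<and> acc \<delta> q' (0 + d * j + r)
     | _ \<Rightarrow> (0::nat) = 0 \<longrightarrow> acc \<delta> q a"
    unfolding good.simps by (elim allE[of _ a] allE[of _ 0] impE) simp_all
  then show "acc \<delta> q a" by (cases "\<delta> q") (simp_all add: acc_iff[of \<delta> q])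
qed

lemma good_step0:
  assumes "owner0 \<delta> x" "(w, y) \<in> set (succs x)" "good y (shift e (pad k w))" "x \<in> S"
  shows "good x e"
proof (cases x)
  case Init
  then have y: "w = init_weight n" "y = Ctl q0 True" using assms(2) by auto
  have "cfg True (int n) 0 (shift (\<lambda>_. 0) (pad k w))"
    by (simp add: y init_weight_def cfg_def own_def shift_pad3)
  then show ?thesis using assms(3) good_CtlD by (auto simp: Init y simp del: good.simps(3))
next
  case (Sink i)
  then have "shift e (pad k w) i = e i" "y = Sink i"
    using assms(2,4) by (simp_all add: sink_weight_def shift_pad)
  then show ?thesis using assms(3) Sink by simp
next
  case (Ctl q s)
  show ?thesis
  proof (cases "\<delta> q")
    case (Update c d R q')
    from assms(2) consider "w = mv s (- int c) (int d)" "y = Over q s"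
      | r where "r \<in> set R" "w = mv s (- int r) (int r)" "y = Exit q s"
      by (auto simp: Ctl Update)
    then have "\<exists>j. \<exists>r\<in>set R. a = c * j + r \<and> acc \<delta> q' (b + d * j + r)"
      if e: "cfg s (int a) (int b) e" for a b
    proof cases
      case 1
      have "cfg s (int a - int c) (int (b + d)) (shift e (pad k (mv s (- int c) (int d))))"
        using cfg_mv[OF e, of "- int c" "int d"] by simp
      then have "\<exists>j. \<exists>r\<in>set R. int a - int c = int (c * j + r) \<and> acc \<delta> q' (b + d + d * j + r)"
        using assms(3)[unfolded 1 good.simps Update instr.case] by blast
      then obtain j r where "r \<in> set R" "int a - int c = int (c * j + r)"
        "acc \<delta> q' (b + d + d * j + r)" by blast
      moreover from this(2) have "int a = int (c * Suc j + r)" by (simp add: algebra_simps)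
      then have "a = c * Suc j + r" by (simp only: of_nat_eq_iff)
      \<comment> \<open>The block just moved precedes the \<open>j\<close> blocks that
        remain.\<close>
      ultimately show ?thesis by (intro exI[of _ "Suc j"] bexI[of _ r]) (simp_all add: add.assoc)
    next
      case 2
      have "cfg s (int a - int r) (int (b + r)) (shift e (pad k (mv s (- int r) (int r))))"
        using cfg_mv[OF e, of "- int r" "int r"] by simp
      then have "int a - int r = 0 \<and> acc \<delta> q' (b + r)"
        using assms(3)[unfolded 2 good.simps Update instr.case] by blast
      then have "a = r" "acc \<delta> q' (b + r)" by simp_all
      then show ?thesis using 2(1) by (intro exI[of _ 0] bexI[of _ r]) simp_all
    qed
    then show ?thesis by (simp add: Ctl Update)
  next
    case (Choice0 qs)
    from assms(2) consider "w = mv s 0 0" "y = Ctl q s"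
      | q' where "q' \<in> set qs" "w = mv s 0 0" "y = Ctl q' s"
      by (auto simp: Ctl Choice0)
    then have "acc \<delta> q a" if e: "cfg s (int a) 0 e" for a
    proof cases
      case 1
      then show ?thesis using assms(3) good_CtlD cfg_mv0[OF e] by blast
    next
      case 2
      then have "acc \<delta> q' a" using assms(3) good_CtlD cfg_mv0[OF e] by blast
      then show ?thesis using acc_Choice0 Choice0 2(1) by metis
    qed
    then show ?thesis by (simp add: Ctl Choice0)
  next
    case (Choice1 qs)
    then show ?thesis using assms(1) by (simp add: Ctl)
  qed
next
  case (Stop s)
  then consider "w = mv s 0 0" "y = Drain s" | "w = mv s 0 0" "y = Sink (own (\<not> s))"
    using assms(2) by auto
  then show ?thesis
  proof cases
    case 1
    then show ?thesis using assms(3) cfg_mv0 unfolding Stop 1 by (simp; blast)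
  next
    case 2
    then have "shift e (pad k (mv s 0 0)) (own (\<not> s)) \<le> 0" using assms(3) by simp
    \<comment> \<open>The sink would require \<open>b + 1 \<le> 0\<close>, which no natural
      \<open>b\<close> satisfies, so nothing is left to show.\<close>
    then show ?thesis using cfg_mv0[of s _ _ e] unfolding Stop by (fastforce simp: cfg_def)
  qed
qed (use assms(1) in auto)

lemma good_step1:
  assumes "\<not> owner0 \<delta> x" "x \<in> S"
    and IH: "\<And>w y. (w, y) \<in> set (succs x) \<Longrightarrow> good y (shift e (pad k w))"
  shows "good x e"
proof (cases x)
  case (Ctl q s)
  then obtain qs where qs: "\<delta> q = Choice1 qs" using assms(1) by (auto split: instr.splits)
  have "acc \<delta> q a" if e: "cfg s (int a) 0 e" for a
  proof (rule acc_Choice1[of \<delta>, OF qs])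
    fix q' assume "q' \<in> set qs"
    then have "good (Ctl q' s) (shift e (pad k (mv s 0 0)))" by (intro IH) (simp add: Ctl qs)
    then show "acc \<delta> q' a" by (rule good_CtlD[OF _ cfg_mv0[OF e]])
  qed
  then show ?thesis by (simp add: Ctl qs)
next
  case (Over q s)
  have "good (Drain s) (shift e (pad k (mv s 0 0)))" by (rule IH) (simp add: Over)
  then have nonneg: "a \<ge> 0" if "cfg s a (int b) e" for a b
    using cfg_mv0[OF that] unfolding good.simps by blast
  have ctl: "good (Ctl q s) (shift e (pad k (mv s 0 0)))" by (rule IH) (simp add: Over)
  show ?thesis
  proof (cases "\<delta> q")
    case (Update c d R q')
    have "\<exists>j. \<exists>r\<in>set R. a = int (c * j + r) \<and> acc \<delta> q' (b + d * j + r)"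
      if e: "cfg s a (int b) e" for a b
    proof -
      obtain a' where a': "a = int a'" using nonneg[OF e] nonneg_int_cases by blast
      have "\<exists>j. \<exists>r\<in>set R. a' = c * j + r \<and> acc \<delta> q' (b + d * j + r)"
        using ctl[unfolded good.simps Update instr.case] cfg_mv0[OF e] unfolding a' by blast
      then show ?thesis unfolding a' by blast
    qed
    then show ?thesis using nonneg by (simp add: Over Update)
  qed (use nonneg in \<open>simp_all add: Over\<close>)
next
  case (Exit q s)
  have "good (Drain s) (shift e (pad k (mv s 0 0)))" by (rule IH) (simp add: Exit)
  then have nonneg: "a \<ge> 0" if "cfg s a (int b) e" for a b
    using cfg_mv0[OF that] unfolding good.simps by blast
  \<comment> \<open>The weight \<open>- 1\<close> cancels the offset in the level
    \<open>a + 1\<close>, so this sink bounds \<open>a\<close> by 0 from above; \<open>Drain\<close>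
    has bounded it from below.\<close>
  have "good (Sink (own s)) (shift e (pad k (if s then [- 1, 0, 0] else [0, - 1, 0])))"
    by (rule IH) (simp add: Exit)
  then have nonpos: "a \<le> 0" if "cfg s a b e" for a b
    using that by (auto simp: cfg_def own_def shift_pad3 split: if_splits)
  have zero: "a = 0" if "cfg s a (int b) e" for a b
    using nonneg nonpos that by (meson order.antisym)
  show ?thesis
  proof (cases "\<delta> q")
    case (Update c d R q')
    have ctl: "good (Ctl q' (\<not> s)) (shift e (pad k (mv s 0 0)))"
      by (rule IH) (simp add: Exit Update)
    have "acc \<delta> q' b" if e: "cfg s a (int b) e" for a b
    proof (rule good_CtlD[OF ctl])
      show "cfg (\<not> s) (int b) 0 (shift e (pad k (mv s 0 0)))"
        using cfg_mv0[OF e] zero[OF e] by (simp add: cfg_swap)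
    qed
    then show ?thesis using zero by (simp add: Exit Update)
  qed (use zero in \<open>simp_all add: Exit\<close>)
next
  case (Drain s)
  have stop: "good (Stop s) (shift e (pad k (mv s 0 (- 1))))" by (rule IH) (simp add: Drain)
  have sink: "good (Sink 2) (shift e (pad k [0, 0, 1]))" by (rule IH) (simp add: Drain)
  have "a \<ge> 0" if e: "cfg s a (int b) e" for a b
  proof (cases b)
    case 0
    \<comment> \<open>With \<open>b = 0\<close> the third level on entering the sink is
      \<open>- a\<close>.\<close>
    then show ?thesis using sink e by (simp add: cfg_def shift_pad3)
  next
    case (Suc b')
    then have "cfg s a (int b') (shift e (pad k (mv s 0 (- 1))))"
      using cfg_mv[OF e, of 0 "- 1"] by simp
    then show ?thesis using stop unfolding good.simps by blast
  qed
  then show ?thesis by (simp add: Drain)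
qed (use assms(1) in auto)

lemma win_good: "win x e \<Longrightarrow> x \<in> S \<Longrightarrow> good x e"
  by (induction rule: win_induct) (simp, blast intro: good_step0, blast intro: good_step1)

lemma win_Init_iff: "win Init (\<lambda>_. 0) \<longleftrightarrow> acc \<delta> q0 n"
proof
  assume "win Init (\<lambda>_. 0)"
  then show "acc \<delta> q0 n" using win_good by fastforce
next
  assume acc: "acc \<delta> q0 n"
  show "win Init (\<lambda>_. 0)"
  proof (rule win_step0)
    show "(init_weight n, Ctl q0 True) \<in> set (succs Init)" by simp
    show "win (Ctl q0 True) (shift (\<lambda>_. 0) (pad k (init_weight n)))"
      by (rule acc_win_Ctl[OF acc q0]) (simp add: init_weight_def cfg_def own_def shift_pad3)
  qed simp_all
qed

subsection \<open>Plays\<close>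

lemma play_run:
  assumes "\<pi> \<in> plays G"
  obtains x w where "\<And>i. \<pi> i = (h (x i), pad k (w i), h (x (Suc i)))" "\<And>i. x i \<in> S"
    "\<And>i. (w i, x (Suc i)) \<in> set (succs (x i))"
proof -
  define x where "x = (\<lambda>i. inv h (src (\<pi> i)))"
  have "\<exists>w. \<pi> i = (h (x i), pad k w, h (x (Suc i))) \<and> x i \<in> S \<and> (w, x (Suc i)) \<in> set (succs (x i))"
    for i
  proof -
    have "\<pi> i \<in> edges G" and nxt: "tgt (\<pi> i) = src (\<pi> (Suc i))" using assms by (auto simp: plays_def)
    then obtain a w b where ab: "\<pi> i = (h a, pad k w, h b)" "a \<in> S" "(w, b) \<in> set (succs a)"
      by (auto simp: edges_G)
    then have "src (\<pi> i) = h a" "src (\<pi> (Suc i)) = h b" using nxt by (simp_all add: src_def tgt_def)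
    then have "x i = a" "x (Suc i) = b" by (simp_all add: x_def inv_f_f[OF inj_h])
    then show ?thesis using ab by blast
  qed
  then have "\<exists>w. \<forall>i. \<pi> i = (h (x i), pad k (w i), h (x (Suc i))) \<and> x i \<in> S \<and>
      (w i, x (Suc i)) \<in> set (succs (x i))" by (intro choice) blast
  then show ?thesis using that by blast
qed

lemma level_Suc:
  assumes "\<pi> m = (a, pad k w, b)"
  shows "level (play_prefix \<pi> (Suc m)) = shift (level (play_prefix \<pi> m)) (pad k w)"
  using assms by (simp add: play_prefix_Suc level_snoc wt_def)

lemma pad_nth_ge3: "length w = 3 \<Longrightarrow> 3 \<le> j \<Longrightarrow> j < k \<Longrightarrow> pad k w ! j = 0"
  by (simp add: pad_def nth_append)

lemma shift_sink_weight:
  "j < 3 \<Longrightarrow> shift e (pad k (sink_weight i)) j = e j - (if j = i then 0 else 1)"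
  by (simp add: shift_pad sink_weight_def)

text \<open>Levels beyond the third are constantly 0, level \<open>i\<close> keeps its nonpositive
  value, and the other two fall by 1 with every move.\<close>

lemma sink_play:
  assumes play: "\<pi> \<in> plays G" and m: "src (\<pi> m) = h (Sink i)" "level (play_prefix \<pi> m) i \<le> 0" "i < 3"
    and j: "j < k"
  shows "limsup_average_energy j \<pi> \<le> 0"
proof -
  let ?e = "\<lambda>m. level (play_prefix \<pi> m)"
  obtain x w where run: "\<And>i. \<pi> i = (h (x i), pad k (w i), h (x (Suc i)))" "\<And>i. x i \<in> S"
    "\<And>i. (w i, x (Suc i)) \<in> set (succs (x i))" by (rule play_run[OF play]) (rule that)
  have e: "?e (Suc m) j = shift (?e m) (pad k (w m)) j" for m by (rule fun_cong[OF level_Suc[OF run(1)]])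
  show ?thesis
  proof (cases "j < 3")
    case False
    have "?e m j = 0" for m
    proof (induction m)
      case 0
      then show ?case by (simp add: play_prefix_0 energy_level_def)
    next
      case (Suc m)
      then show ?case using False j length_succs[OF run(3)[of m]]
        by (simp add: e shift_def pad_nth_ge3)
    qed
    then show ?thesis by (intro limsup_average_energy_le_0[of 0]) simp
  next
    case True
    have inv: "x (m + t) = Sink i \<and> ?e (m + t) j = ?e m j - (if j = i then 0 else int t)" for t
    proof (induction t)
      case 0
      then show ?case using m(1) run(1)[of m] by (simp add: src_def)
    next
      case (Suc t)
      have "w (m + t) = sink_weight i" "x (Suc (m + t)) = Sink i" using run(3)[of "m + t"] Suc by simp_all
      then show ?case using Suc True by (simp add: e shift_sink_weight)
    qed
    show ?thesis
    proof (rule limsup_average_energy_le_0)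
      \<comment> \<open>After as many moves as its absolute value on entry, a falling level is
        nonpositive.\<close>
      fix r assume r: "m + nat \<bar>?e m j\<bar> \<le> r"
      then have "?e r j = ?e m j - (if j = i then 0 else int (r - m))" using inv[of "r - m"] by simp
      then show "?e r j \<le> 0" using r m(2) by (auto split: if_splits)
    qed
  qed
qed

lemma winning_if_acc:
  assumes "acc \<delta> q0 n"
  shows "has_winning_strategy0 G (h Init) (AE_objective G (replicate k 0))"
proof -
  have "attr G base (h Init) (\<lambda>_. 0)" using assms win_Init_iff by (simp add: win_def)
  from attr_strategy[OF edges_G_total disjoint_G this] obtain \<sigma> where \<sigma>: "strategy0 G \<sigma>"
    "\<And>\<pi>. \<pi> \<in> outcomes0 G \<sigma> (h Init) \<Longrightarrow> \<exists>m. base (src (\<pi> m)) (level (play_prefix \<pi> m))" by blast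
  have "\<pi> \<in> AE_objective G (replicate k 0)" if out: "\<pi> \<in> outcomes0 G \<sigma> (h Init)" for \<pi>
  proof -
    have play: "\<pi> \<in> plays G" using out by (simp add: outcomes0_def)
    obtain m i where "i < 3" "src (\<pi> m) = h (Sink i)" "level (play_prefix \<pi> m) i \<le> 0"
      using \<sigma>(2)[OF out] by (auto simp: base_def)
    then show ?thesis using play sink_play[OF play]
      by (auto simp: AE_objective_def zero_ereal_def[symmetric])
  qed
  then show ?thesis using \<sigma>(1) unfolding has_winning_strategy0_def by blast
qed

section \<open>Counterplay of the second player\<close>

definition urgent :: "'q st \<Rightarrow> bool" where
  "urgent y \<longleftrightarrow> (case y of Sink i \<Rightarrow> True | Drain s \<Rightarrow> True | _ \<Rightarrow> False)"

text \<open>By \<open>pref\<close>, an edge into a sink or \<open>Drain\<close> is declined only if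
  the first player would have won there. A run that reaches a sink without being won keeps its level
  at least 1. Endless draining is contradictory, as the third level grows until
  \<open>Sink 2\<close> would be lost for the first player. In the remaining case all declined
  objections were unjustified, so both counters stay nonnegative and the first level stays
  positive.\<close>

lemma losing_run:
  assumes x: "x 0 = Init" "\<And>i. x i \<in> S" "\<And>i. (w i, x (Suc i)) \<in> set (succs (x i))"
    and e: "e 0 = (\<lambda>_. 0)" "\<And>i. e (Suc i) = shift (e i) (pad k (w i))"
    and lose: "\<And>i. \<not> win (x i) (e i)"
    and pref: "\<And>i v y. \<not> owner0 \<delta> (x i) \<Longrightarrow> \<not> urgent (x (Suc i)) \<Longrightarrow> (v, y) \<in> set (succs (x i)) \<Longrightarrow>
      urgent y \<Longrightarrow> win y (shift (e i) (pad k v))"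
  shows "\<exists>j<3. \<exists>M. \<forall>m\<ge>M. e m j \<ge> 1"
proof -
  consider m i where "x m = Sink i"
    | m s where "\<And>m i. x m \<noteq> Sink i" "x m = Drain s \<or> x m = Stop s"
    | "\<And>m i. x m \<noteq> Sink i" "\<And>m s. x m \<noteq> Drain s" "\<And>m s. x m \<noteq> Stop s"
    by blast
  then show ?thesis
  proof cases
    case 1
    have i: "i < 3" using x(2)[of m] 1 by simp
    have "x (m + t) = Sink i \<and> e (m + t) i = e m i" for t
    proof (induction t)
      case (Suc t)
      then show ?case using x(3)[of "m + t"] i by (simp add: e shift_sink_weight)
    qed (simp add: 1)
    moreover have "e m i \<ge> 1" using lose[of m] win_Sink[OF i, of "e m"] unfolding 1 by linarith
    ultimately have "\<forall>r\<ge>m. e r i \<ge> 1" by (metis le_add_diff_inverse)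
    then show ?thesis using i by blast
  next
    case 2
    have stop: "x (Suc r) = Drain s" "w r = mv s 0 0" if "x r = Stop s" for r s
      using x(3)[of r] 2(1)[of "Suc r"] that by auto
    have drain: "x (Suc r) = Stop s" "w r = mv s 0 (- 1)" if "x r = Drain s" for r s
      using x(3)[of r] 2(1)[of "Suc r"] that by auto
    obtain m s where m: "x m = Drain s" using 2(2) stop(1) by blast
    have inv: "x (m + 2 * t) = Drain s \<and> e (m + 2 * t) 2 = e m 2 + int t" for t
    proof (induction t)
      case (Suc t)
      then have "x (m + 2 * t) = Drain s" by simp
      from drain[OF this] stop[OF drain(1)[OF this]] Suc show ?case
        by (auto simp: e mv_def shift_pad3)
    qed (simp add: m)
    \<comment> \<open>A round through \<open>Drain\<close> and \<open>Stop\<close> takes two moves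
      and raises the third level by 1, so after this many rounds it is nonnegative.\<close>
    define r where "r = m + 2 * nat \<bar>e m 2\<bar>"
    have r: "x r = Drain s" "e r 2 \<ge> 0" using inv[of "nat \<bar>e m 2\<bar>"] by (auto simp: r_def)
    have "win (Sink 2) (shift (e r) (pad k [0, 0, 1]))"
      using drain(1)[OF r(1)] by (intro pref) (simp_all add: r(1) urgent_def)
    then have "shift (e r) (pad k [0, 0, 1]) 2 \<le> 0" using win_good by fastforce
    then show ?thesis using r(2) by (simp add: shift_pad3)
  next
    case 3
    \<comment> \<open>The invariant starts after the initial edge: at time 0 the levels add up to 0,
      whereas those of a configuration add up to 1.\<close>
    have inv: "(\<exists>s a b. cfg s (int a) (int b) (e (Suc m))) \<and> x (Suc m) \<noteq> Init" for m
    proof (induction m)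
      case 0
      have "cfg True (int n) (int 0) (e 1)"
        using x(1) x(3)[of 0] by (simp add: e init_weight_def cfg_def own_def shift_pad3)
      moreover have "x 1 \<noteq> Init" using x(1) x(3)[of 0] by simp
      ultimately show ?case by (metis One_nat_def)
    next
      case (Suc m)
      then obtain s0 a b where cfg: "cfg s0 (int a) (int b) (e (Suc m))" by blast
      \<comment> \<open>As \<open>Drain\<close> was not entered, the first player would have won
        there, and by \<open>win_good\<close> this means that \<open>a'\<close> is
        nonnegative.\<close>
      have nonneg: "a' \<ge> 0"
        if "x r = Over q s \<or> x r = Exit q s" "cfg s a' (int b') (e r)" for r q s a' b'
      proof -
        have "\<not> urgent (x (Suc r))"
          using 3(1)[of "Suc r"] 3(2)[of "Suc r"] by (auto simp: urgent_def split: st.splits)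
        then have "win (Drain s) (shift (e r) (pad k (mv s 0 0)))"
          using that(1) by (intro pref) (auto simp: urgent_def)
        then have "good (Drain s) (shift (e r) (pad k (mv s 0 0)))" by (rule win_good) simp
        then show ?thesis using cfg_mv0[OF that(2)] unfolding good.simps by blast
      qed
      have cfg': "\<exists>a b. cfg s (int a) (int b) (e (Suc m))" for s
        using cfg cfg_swap[of s] by (cases "s = s0") auto
      have step: "(w (Suc m), x (Suc (Suc m))) \<in> set (succs (x (Suc m)))" by (rule x(3))
      have e': "e (Suc (Suc m)) = shift (e (Suc m)) (pad k (w (Suc m)))" by (rule e(2))
      have keep: ?case if "w (Suc m) = mv s 0 0" "x (Suc (Suc m)) = Ctl q s'" for q s s'
        using cfg'[of s] cfg_mv0 unfolding e' that by blast
      have moved: ?case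
        if "w (Suc m) = mv s (- int c) (int d)"
          "x (Suc (Suc m)) = Over q s \<or> x (Suc (Suc m)) = Exit q s" for q s c d
      proof -
        obtain a b where ab: "cfg s (int a) (int b) (e (Suc m))" using cfg' by blast
        have c: "cfg s (int a - int c) (int (b + d)) (e (Suc (Suc m)))"
          using cfg_mv[OF ab, of "- int c" "int d"] unfolding e' that(1) by simp
        have "int a - int c \<ge> 0" by (rule nonneg[OF that(2) c])
        then obtain a' where "int a - int c = int a'" by (rule nonneg_int_cases)
        then have "cfg s (int a') (int (b + d)) (e (Suc (Suc m)))" using c by simp
        then show ?thesis using that(2) by (intro conjI) (blast, auto)
      qed
      show ?case
      proof (cases "x (Suc m)")
        case (Ctl q s)
        show ?thesis
        proof (cases "\<delta> q")
          case (Update c d R q')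
          then consider "w (Suc m) = mv s (- int c) (int d)" "x (Suc (Suc m)) = Over q s"
            | r where "w (Suc m) = mv s (- int r) (int r)" "x (Suc (Suc m)) = Exit q s"
            using step by (auto simp: Ctl)
          then show ?thesis using moved by cases blast+
        next
          case (Choice0 qs)
          then show ?thesis using step keep by (auto simp: Ctl)
        next
          case (Choice1 qs)
          then show ?thesis using step keep 3(1)[of "Suc (Suc m)"] by (auto simp: Ctl)
        qed
      next
        case (Over q s)
        then show ?thesis using step keep 3(2)[of "Suc (Suc m)"] by auto
      next
        case (Exit q s)
        then show ?thesis using step keep 3(1,2)[of "Suc (Suc m)"]
          by (auto split: instr.splits)
      qed (use Suc.IH 3 in auto)
    qed
    have "e (Suc m) 0 \<ge> 1" for m
    proof -
      obtain s a b where "cfg s (int a) (int b) (e (Suc m))" using inv by blast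
      then show ?thesis by (cases s) (auto simp: cfg_def own_def)
    qed
    then have "\<forall>m\<ge>1. e m 0 \<ge> 1" by (metis One_nat_def Suc_le_D)
    then show ?thesis by (intro exI[of _ 0]) auto
  qed
qed

text \<open>If the start number is not accepted, the initial configuration is outside the attractor.
  Every strategy then has an outcome that stays outside and on which the second player prefers
  justified objections; by \<open>losing_run\<close> one of its levels is eventually at least 1, and
  so is the limit superior.\<close>

lemma acc_if_winning:
  assumes "has_winning_strategy0 G (h Init) (AE_objective G (replicate k 0))"
  shows "acc \<delta> q0 n"
proof (rule ccontr)
  assume "\<not> acc \<delta> q0 n"
  then have lose: "\<not> attr G base (h Init) (\<lambda>_. 0)" using win_Init_iff by (simp add: win_def)
  obtain \<sigma> where \<sigma>: "strategy0 G \<sigma>" "outcomes0 G \<sigma> (h Init) \<subseteq> AE_objective G (replicate k 0)"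
    using assms by (auto simp: has_winning_strategy0_def)
  have "h Init \<in> states G" by simp
  from not_attr_outcome[OF edges_G_states finite_edges_G \<sigma>(1) this lose, of "h ` {y. urgent y}"]
  obtain \<pi> where out: "\<pi> \<in> outcomes0 G \<sigma> (h Init)"
    and \<pi>: "\<And>i. \<not> attr G base (src (\<pi> i)) (level (play_prefix \<pi> i))"
      "\<And>i d. src (\<pi> i) \<in> states1 G - states0 G \<Longrightarrow> tgt (\<pi> i) \<notin> h ` {y. urgent y} \<Longrightarrow>
        d \<in> edges G \<Longrightarrow> src d = src (\<pi> i) \<Longrightarrow> tgt d \<in> h ` {y. urgent y} \<Longrightarrow>
        attr G base (tgt d) (shift (level (play_prefix \<pi> i)) (wt d))" by blast
  have play: "\<pi> \<in> plays G" and init: "src (\<pi> 0) = h Init" using out by (auto simp: outcomes0_def)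
  obtain x w where run: "\<And>i. \<pi> i = (h (x i), pad k (w i), h (x (Suc i)))" "\<And>i. x i \<in> S"
    "\<And>i. (w i, x (Suc i)) \<in> set (succs (x i))" by (rule play_run[OF play]) (rule that)
  have src: "src (\<pi> i) = h (x i)" and tgt: "tgt (\<pi> i) = h (x (Suc i))" for i
    using run(1)[of i] by (simp_all add: src_def tgt_def)
  have "\<exists>j<3. \<exists>M. \<forall>m\<ge>M. level (play_prefix \<pi> m) j \<ge> 1"
  proof (rule losing_run[of x w])
    show "x 0 = Init" using init by (simp add: src)
    show "level (play_prefix \<pi> (Suc i)) = shift (level (play_prefix \<pi> i)) (pad k (w i))" for i
      by (rule level_Suc[OF run(1)])
    show "\<not> win (x i) (level (play_prefix \<pi> i))" for i using \<pi>(1)[of i] by (simp add: win_def src)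
    show "win y (shift (level (play_prefix \<pi> i)) (pad k v))"
      if "\<not> owner0 \<delta> (x i)" "\<not> urgent (x (Suc i))" "(v, y) \<in> set (succs (x i))" "urgent y" for i v y
    proof -
      have "(h (x i), pad k v, h y) \<in> edges G" using run(2) that(3) by (auto simp: edges_G)
      then have "attr G base (tgt (h (x i), pad k v, h y))
          (shift (level (play_prefix \<pi> i)) (wt (h (x i), pad k v, h y)))"
        using that run(2) by (intro \<pi>(2)) (auto simp: src tgt src_def[of "(_, _)"] tgt_def[of "(_, _)"])
      then show ?thesis by (simp add: win_def tgt_def wt_def)
    qed
  qed (use run in \<open>simp_all add: play_prefix_0 level_Nil\<close>)
  then obtain j where j: "j < 3" "limsup_average_energy j \<pi> \<ge> 1"
    using limsup_average_energy_ge_1 by blast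
  have "limsup_average_energy j \<pi> \<le> 0"
    using out \<sigma>(2) j(1) k by (auto simp: AE_objective_def zero_ereal_def[symmetric])
  with j(2) have "(1::ereal) \<le> 0" by (rule order.trans)
  then show False by simp
qed

lemma winning_iff_acc:
  "has_winning_strategy0 G (h Init) (AE_objective G (replicate k 0)) \<longleftrightarrow> acc \<delta> q0 n"
  using winning_if_acc acc_if_winning by blast

end

section \<open>Recursive functions as programs\<close>

definition prm :: "nat \<Rightarrow> nat" where
  "prm = enumerate {p. prime p}"

lemma prime_prm: "prime (prm i)"
  using enumerate_in_set[OF primes_infinite] by (simp add: prm_def)

lemma prm_eq_iff [simp]: "prm i = prm j \<longleftrightarrow> i = j"
  unfolding prm_def by (rule inj_eq[OF inj_enumerate[OF primes_infinite]])

lemma prm_pos [simp]: "prm i > 0"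
  by (rule prime_gt_0_nat[OF prime_prm])

definition reg :: "nat \<Rightarrow> nat \<Rightarrow> nat" where
  "reg n i = multiplicity (prm i) n"

lemma reg_mult: "m > 0 \<Longrightarrow> n > 0 \<Longrightarrow> reg (m * n) i = reg m i + reg n i"
  unfolding reg_def
  by (intro prime_elem_multiplicity_mult_distrib prime_imp_prime_elem prime_prm) simp_all

lemma reg_prm_power: "reg (prm i ^ x) k = (if k = i then x else 0)"
  unfolding reg_def using multiplicity_prime_power[OF prime_imp_prime_elem[OF prime_prm]]
    multiplicity_distinct_prime_power[OF prime_prm prime_prm]
  by (metis prm_eq_iff)

lemma reg_prm_mult: "n > 0 \<Longrightarrow> reg (prm i * n) = (reg n)(i := Suc (reg n i))"
  using reg_prm_power[of i 1] by (simp add: fun_eq_iff reg_mult)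

lemma reg_eq_0_iff:
  assumes "n > 0"
  shows "reg n i = 0 \<longleftrightarrow> \<not> prm i dvd n"
proof -
  have "\<not> is_unit (prm i)" using prime_prm[of i] by (metis not_prime_unit)
  then show ?thesis unfolding reg_def using assms by (intro multiplicity_eq_zero_iff) simp_all
qed

text \<open>\<open>Any\<close> and \<open>All\<close> are choices of the first and the second
  player, so \<open>All []\<close> accepts. With \<open>Havoc i\<close> the first player writes any
  value into a register; with \<open>Down i\<close> the second player lowers it to any smaller or
  equal value.\<close>

datatype prog =
    Inc nat prog
  | Dec nat prog
  | Zer nat prog
  | Any "prog list"
  | All "prog list"
  | Havoc nat prog
  | Down nat prog
  | Same nat nat
  | Claim recfun "nat list" nat nat
  | PR recfun recfun nat "nat list" nat nat nat

instance recfun :: countable by countable_datatype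

instance prog :: countable by countable_datatype

text \<open>\<open>Claim f is j b\<close> is the assertion of \<open>P\<^sub>0\<close> that \<open>f\<close>, applied to the registers \<open>is\<close>, has the
  value in register \<open>j\<close>; the registers from \<open>b\<close> on are free. In \<open>PR f g n is j j' b\<close> the
  registers \<open>j\<close> and \<open>j'\<close> take turns in holding the asserted value, so that the unfolded
  recursion visits finitely many programs.\<close>

fun step :: "prog \<Rightarrow> prog instr" where
  "step (Inc i q) = Update 1 (prm i) [0] q"
| "step (Dec i q) = Update (prm i) 1 [0] q"
| "step (Zer i q) = Update (prm i) (prm i) [1..<prm i] q"
| "step (Any qs) = Choice0 qs"
| "step (All qs) = Choice1 qs"
| "step (Havoc i q) = Choice0 [q, Inc i (Havoc i q), Dec i (Havoc i q)]"
| "step (Down i q) = Choice1 [q, Any [Zer i (All []), Dec i (Down i q)]]"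
| "step (Same i j) = Choice0 [Zer i (Zer j (All [])), Dec i (Dec j (Same i j))]"
| "step (Claim Zero is j b) = Choice0 [Zer j (All [])]"
| "step (Claim Succ is j b) = Choice0 (case is of [i] \<Rightarrow> [Dec j (Same i j)] | _ \<Rightarrow> [])"
| "step (Claim (Proj l) is j b) = Choice0 (if l < length is then [Same (is ! l) j] else [])"
| "step (Claim (Comp f gs) is j b) = (let l = length gs in
     Choice0 [foldr Havoc [b..<b + l] (All (Claim f [b..<b + l] j (b + l) #
       map (\<lambda>i. Claim (gs ! i) is (b + i) (b + l)) [0..<l]))])"
| "step (Claim (PrimRec f g) is j b) =
     Choice0 (case is of [] \<Rightarrow> [] | n # is' \<Rightarrow> [PR f g n is' j b (Suc b)])"
| "step (PR f g n is j j' b) = Choice0 [Zer n (Claim f is j b),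
     Dec n (Havoc j' (All [Claim g (n # j' # is) j b, PR f g n is j' j b]))]"
| "step (Claim (Mu f) is j b) = Choice1
     [Havoc b (Zer b (Claim f (j # is) b (Suc b))),
      Any [Zer j (All []),
        Dec j (Down j (Havoc b (Dec b (Inc b (Claim f (j # is) b (Suc b))))))]]"

subsection \<open>Correctness of the programs\<close>

abbreviation accepts :: "prog \<Rightarrow> nat \<Rightarrow> bool" where
  "accepts \<equiv> acc step"

text \<open>The number 0 is excluded because it can be divided by a prime forever and so does not
  represent register contents.\<close>

definition sem :: "prog \<Rightarrow> ((nat \<Rightarrow> nat) \<Rightarrow> bool) \<Rightarrow> bool" where
  "sem q P \<longleftrightarrow> (\<forall>n>0. accepts q n \<longleftrightarrow> P (reg n))"

lemma semD: "sem q P \<Longrightarrow> n > 0 \<Longrightarrow> accepts q n \<longleftrightarrow> P (reg n)"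
  by (simp add: sem_def)

lemma accepts_Any: "accepts (Any qs) n \<longleftrightarrow> (\<exists>q\<in>set qs. accepts q n)"
  by (subst acc_iff) simp

lemma accepts_All: "accepts (All qs) n \<longleftrightarrow> (\<forall>q\<in>set qs. accepts q n)"
  by (subst acc_iff) simp

lemma accepts_Inc: "accepts (Inc i q) n \<longleftrightarrow> accepts q (prm i * n)"
  by (subst acc_iff) simp

lemma accepts_Dec: "accepts (Dec i q) n \<longleftrightarrow> (\<exists>m. n = prm i * m \<and> accepts q m)"
  by (subst acc_iff) simp

lemma accepts_Zer: "n > 0 \<Longrightarrow> accepts (Zer i q) n \<longleftrightarrow> reg n i = 0 \<and> accepts q n"
proof -
  assume n: "n > 0"
  have "accepts (Zer i q) n \<longleftrightarrow> (\<exists>j. \<exists>r\<in>{1..<prm i}. n = prm i * j + r \<and> accepts q n)"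
    by (subst acc_iff) auto
  also have "\<dots> \<longleftrightarrow> \<not> prm i dvd n \<and> accepts q n"
  proof (intro iffI conjI; elim exE bexE conjE)
    fix j r assume r: "r \<in> {1..<prm i}" "n = prm i * j + r"
    then show "\<not> prm i dvd n" by (auto simp: dvd_add_right_iff dest: nat_dvd_not_less)
  next
    assume "\<not> prm i dvd n" "accepts q n"
    then have "n mod prm i \<in> {1..<prm i}" "n = prm i * (n div prm i) + n mod prm i"
      by (auto simp: dvd_eq_mod_eq_0 Suc_le_eq)
    then show "\<exists>j. \<exists>r\<in>{1..<prm i}. n = prm i * j + r \<and> accepts q n"
      using \<open>accepts q n\<close> by blast
  qed
  finally show ?thesis using reg_eq_0_iff[OF n] by simp
qed

lemma sem_Inc: "sem q P \<Longrightarrow> sem (Inc i q) (\<lambda>v. P (v(i := Suc (v i))))"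
  by (auto simp: sem_def accepts_Inc reg_prm_mult)

lemma accepts_DecD:
  assumes "n > 0" "accepts (Dec i q) n"
  shows "reg n i > 0 \<and> (\<exists>m>0. accepts q m \<and> reg m = (reg n)(i := reg n i - 1))"
proof -
  obtain m where m: "n = prm i * m" "accepts q m" using assms(2) by (auto simp: accepts_Dec)
  then have pos: "m > 0" using assms(1) by simp
  have "reg n = (reg m)(i := Suc (reg m i))" unfolding m(1) by (rule reg_prm_mult[OF pos])
  then have "reg n i > 0" "reg m = (reg n)(i := reg n i - 1)" by (simp_all add: fun_eq_iff)
  then show ?thesis using pos m(2) by blast
qed

lemma accepts_DecI:
  assumes "n > 0" "reg n i > 0"
    and "\<And>m. m > 0 \<Longrightarrow> reg m = (reg n)(i := reg n i - 1) \<Longrightarrow> accepts q m"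
  shows "accepts (Dec i q) n"
proof -
  obtain m where m: "n = prm i * m" using assms(1,2) reg_eq_0_iff[of n i] by (auto elim: dvdE)
  then have "m > 0" using assms(1) by simp
  then have "accepts q m" using assms(3) by (simp add: m reg_prm_mult)
  then show ?thesis using m by (auto simp: accepts_Dec)
qed

lemma sem_Dec: "sem q P \<Longrightarrow> sem (Dec i q) (\<lambda>v. v i > 0 \<and> P (v(i := v i - 1)))"
  unfolding sem_def by (metis accepts_DecD accepts_DecI)

lemma sem_Zer: "sem q P \<Longrightarrow> sem (Zer i q) (\<lambda>v. v i = 0 \<and> P v)"
  by (simp add: sem_def accepts_Zer)

lemma sem_accept: "sem (All []) (\<lambda>_. True)"
  by (simp add: sem_def accepts_All)

text \<open>Equality up to powers of one prime, written without division; a multiplication or a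
  division by that prime obviously preserves it.\<close>

definition same_but :: "nat \<Rightarrow> nat \<Rightarrow> nat \<Rightarrow> bool" where
  "same_but i n m \<longleftrightarrow> (\<exists>x y. m * prm i ^ x = n * prm i ^ y)"

lemma same_but_trans: "same_but i n m \<Longrightarrow> same_but i m l \<Longrightarrow> same_but i n l"
proof -
  assume "same_but i n m" "same_but i m l"
  then obtain x y z w where "m * prm i ^ x = n * prm i ^ y" "l * prm i ^ z = m * prm i ^ w"
    by (auto simp: same_but_def)
  then have "l * prm i ^ (z + x) = n * prm i ^ (y + w)"
    by (metis mult.assoc mult.commute power_add)
  then show ?thesis by (auto simp: same_but_def)
qed

lemma reg_same_but:
  assumes "same_but i n m" "m > 0" "n > 0"
  shows "reg m = (reg n)(i := reg m i)"
proof
  fix k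
  obtain x y where "m * prm i ^ x = n * prm i ^ y" using assms(1) by (auto simp: same_but_def)
  then have "reg (m * prm i ^ x) k = reg (n * prm i ^ y) k" by simp
  then show "reg m k = ((reg n)(i := reg m i)) k"
    using assms(2,3) by (simp add: reg_mult reg_prm_power split: if_splits)
qed

lemma same_but_update:
  assumes "n > 0"
  shows "\<exists>m>0. same_but i n m \<and> reg m = (reg n)(i := x)"
proof -
  obtain u where u: "n = prm i ^ reg n i * u"
    unfolding reg_def using multiplicity_dvd by (metis dvdE)
  \<comment> \<open>All factors \<open>prm i\<close> are removed from \<open>n\<close> and
    \<open>x\<close> of them are put back.\<close>
  define m where "m = prm i ^ x * u"
  have pos: "m > 0" "u > 0" using u assms by (auto simp: m_def intro: gr0I)
  have "reg n i = reg n i + reg u i"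
    by (subst u) (simp add: reg_mult pos reg_prm_power)
  then have "reg m i = x" using pos by (simp add: m_def reg_mult reg_prm_power)
  moreover have "m * prm i ^ reg n i = n * prm i ^ x" by (subst (2) u) (simp add: m_def)
  then have "same_but i n m" by (auto simp: same_but_def)
  ultimately show ?thesis using reg_same_but[of i n m] pos assms by auto
qed

text \<open>Acceptance is inductive, so the first player has to leave the loop, and by then the
  number has changed by powers of \<open>prm i\<close> only. Conversely, \<open>n\<close> is first
  multiplied up to a common multiple of the form in \<open>same_but\<close> and then divided down to
  \<open>m\<close>.\<close>

lemma accepts_Havoc:
  assumes "n > 0"
  shows "accepts (Havoc i q) n \<longleftrightarrow> (\<exists>m>0. same_but i n m \<and> accepts q m)"
proof
  have step: "same_but i n (prm i * n)" "same_but i (prm i * n) n" for n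
    unfolding same_but_def by (intro exI[of _ 0] exI[of _ 1]; simp) (intro exI[of _ 1] exI[of _ 0]; simp)
  let ?T = "{Havoc i q, Inc i (Havoc i q), Dec i (Havoc i q)}"
  have "\<exists>m>0. same_but i n m \<and> accepts q m" if "accepts q' n" "q' \<in> ?T" "n > 0" for q' n
    using that
  proof (induction rule: acc.induct)
    case (acc_Update q0 c d R q' r j)
    then have IH: "\<exists>m>0. same_but i (d * j + r) m \<and> accepts q m" by auto
    have "same_but i (c * j + r) (d * j + r)" using acc_Update.hyps acc_Update.prems step[of j] by auto
    then show ?case using IH same_but_trans by blast
  next
    case (acc_Choice0 q0 qs q' n)
    have refl: "same_but i n n" by (auto simp: same_but_def)
    have "q' = q \<or> q' \<in> ?T" using acc_Choice0.hyps acc_Choice0.prems by auto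
    then show ?case
    proof
      assume "q' = q"
      then show ?case using refl acc_Choice0.hyps acc_Choice0.prems by blast
    qed (use acc_Choice0 in blast)
  next
    case (acc_Choice1 q0 qs n)
    then show ?case by auto
  qed
  then show "accepts (Havoc i q) n \<Longrightarrow> \<exists>m>0. same_but i n m \<and> accepts q m" using assms by blast
next
  have up: "accepts (Havoc i q) n" if "accepts (Havoc i q) (n * prm i ^ x)" for n x
    using that
  proof (induction x)
    case (Suc x)
    then have "accepts (Inc i (Havoc i q)) (n * prm i ^ x)"
      by (simp add: accepts_Inc mult.left_commute)
    then have "accepts (Havoc i q) (n * prm i ^ x)" by (subst acc_iff) simp
    then show ?case by (rule Suc.IH)
  qed simp
  have down: "accepts (Havoc i q) (n * prm i ^ x)" if "accepts (Havoc i q) n" for n x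
  proof (induction x)
    case (Suc x)
    then have "accepts (Dec i (Havoc i q)) (n * prm i ^ Suc x)"
      unfolding accepts_Dec by (intro exI[of _ "n * prm i ^ x"]) simp
    then show ?case by (subst acc_iff) simp
  qed (simp add: that)
  assume "\<exists>m>0. same_but i n m \<and> accepts q m"
  then obtain m x y where m: "m * prm i ^ x = n * prm i ^ y" "accepts q m"
    by (auto simp: same_but_def)
  then have "accepts (Havoc i q) m" by (subst acc_iff) simp
  then have "accepts (Havoc i q) (n * prm i ^ y)" using down m(1) by metis
  then show "accepts (Havoc i q) n" by (rule up)
qed

lemma sem_Havoc: "sem q P \<Longrightarrow> sem (Havoc i q) (\<lambda>v. \<exists>x. P (v(i := x)))"
  unfolding sem_def
  by (metis accepts_Havoc reg_same_but same_but_update)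

lemma sem_foldr_Havoc:
  assumes "sem q P"
  shows "sem (foldr Havoc bs q) (\<lambda>v. \<exists>w. (\<forall>k. k \<notin> set bs \<longrightarrow> w k = v k) \<and> P w)"
proof (induction bs)
  case Nil
  have "(\<exists>w. (\<forall>k. w k = v k) \<and> P w) \<longleftrightarrow> P v" for v by (metis ext)
  then show ?case using assms by simp
next
  case (Cons a bs)
  have "(\<exists>x w. (\<forall>k. k \<notin> set bs \<longrightarrow> w k = (v(a := x)) k) \<and> P w) \<longleftrightarrow>
    (\<exists>w. (\<forall>k. k \<notin> set (a # bs) \<longrightarrow> w k = v k) \<and> P w)" for v
  proof (intro iffI; elim exE conjE)
    fix w assume "\<forall>k. k \<notin> set (a # bs) \<longrightarrow> w k = v k" "P w"
    then show "\<exists>x w. (\<forall>k. k \<notin> set bs \<longrightarrow> w k = (v(a := x)) k) \<and> P w"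
      by (intro exI[of _ "w a"] exI[of _ w]) auto
  qed (metis fun_upd_other list.set_intros)
  then show ?case using sem_Havoc[OF Cons.IH, of a] by simp
qed

text \<open>At each value the second player stops or demands a further decrement; the first player
  can refuse only at 0. The induction is on the value of the register.\<close>

lemma sem_Down:
  assumes "sem q P"
  shows "sem (Down i q) (\<lambda>v. \<forall>x\<le>v i. P (v(i := x)))"
proof -
  have "accepts (Down i q) n \<longleftrightarrow> (\<forall>x\<le>reg n i. P ((reg n)(i := x)))" if "n > 0" for n
    using that
  proof (induction "reg n i" arbitrary: n)
    case 0
    then have "accepts (Any [Zer i (All []), Dec i (Down i q)]) n"
      by (simp add: accepts_Any accepts_Zer accepts_All)
    then have "accepts (Down i q) n \<longleftrightarrow> accepts q n" by (subst acc_iff) simp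
    also have "\<dots> \<longleftrightarrow> P ((reg n)(i := 0))" using 0 semD[OF assms] by (metis fun_upd_triv)
    also have "\<dots> \<longleftrightarrow> (\<forall>x\<le>0. P ((reg n)(i := x)))" by (metis le_zero_eq)
    finally show ?case unfolding 0(1)[symmetric] .
  next
    case (Suc x)
    let ?Q = "\<lambda>v. \<forall>x\<le>v i. P (v(i := x))"
    have "accepts (Dec i (Down i q)) n \<longleftrightarrow> ?Q ((reg n)(i := x))"
    proof
      assume "accepts (Dec i (Down i q)) n"
      then obtain m where "m > 0" "accepts (Down i q) m" "reg m = (reg n)(i := x)"
        using accepts_DecD[OF Suc.prems] Suc.hyps(2) by (metis diff_Suc_1)
      then show "?Q ((reg n)(i := x))" using Suc.hyps(1)[of m] by simp
    next
      assume Q: "?Q ((reg n)(i := x))"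
      show "accepts (Dec i (Down i q)) n"
      proof (rule accepts_DecI)
        fix m assume "m > 0" "reg m = (reg n)(i := reg n i - 1)"
        then show "accepts (Down i q) m"
          using Suc.hyps(1)[of m] Q Suc.hyps(2)[symmetric] by simp
      qed (use Suc in auto)
    qed
    moreover have "accepts (Down i q) n \<longleftrightarrow> accepts q n \<and> accepts (Dec i (Down i q)) n"
      using Suc by (subst acc_iff) (simp add: accepts_Any accepts_Zer)
    moreover have "accepts q n \<longleftrightarrow> P ((reg n)(i := Suc x))"
      using semD[OF assms] Suc by (metis fun_upd_triv)
    ultimately show ?case using Suc.hyps(2)[symmetric] by (auto simp: le_Suc_eq)
  qed
  then show ?thesis by (simp add: sem_def)
qed

text \<open>Both registers are counted down together and must vanish at the same time. With
  \<open>i = j\<close> a round would lower the register twice and reject odd values.\<close>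

lemma sem_Same:
  assumes "i \<noteq> j"
  shows "sem (Same i j) (\<lambda>v. v i = v j)"
proof -
  have "accepts (Same i j) n \<longleftrightarrow> reg n i = reg n j" if "n > 0" for n
    using that
  proof (induction "reg n i" arbitrary: n)
    case 0
    then have "\<not> accepts (Dec i (Dec j (Same i j))) n"
      using accepts_DecD[OF 0(2)] by (metis less_irrefl)
    then have "accepts (Same i j) n \<longleftrightarrow> accepts (Zer i (Zer j (All []))) n"
      by (subst acc_iff) simp
    then show ?case using 0 by (simp add: accepts_Zer accepts_All)
  next
    case (Suc x)
    have "accepts (Same i j) n \<longleftrightarrow> accepts (Dec i (Dec j (Same i j))) n"
      using Suc by (subst acc_iff) (simp add: accepts_Zer)
    also have "\<dots> \<longleftrightarrow> reg n i = reg n j"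
    proof
      assume "accepts (Dec i (Dec j (Same i j))) n"
      then obtain m where m: "m > 0" "accepts (Dec j (Same i j)) m" "reg m = (reg n)(i := x)"
        using accepts_DecD[OF Suc.prems] Suc.hyps(2) by (metis diff_Suc_1)
      then obtain l where l: "l > 0" "accepts (Same i j) l" "reg m j > 0"
        "reg l = (reg m)(j := reg m j - 1)"
        using accepts_DecD[OF m(1,2)] by blast
      then have "reg l i = reg l j" using Suc.hyps(1)[of l] m(3) assms by simp
      then show "reg n i = reg n j" using l m assms Suc.hyps(2) by simp
    next
      assume eq: "reg n i = reg n j"
      show "accepts (Dec i (Dec j (Same i j))) n"
      proof (rule accepts_DecI)
        fix m assume m: "m > 0" "reg m = (reg n)(i := reg n i - 1)"
        show "accepts (Dec j (Same i j)) m"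
        proof (rule accepts_DecI)
          fix l assume "l > 0" "reg l = (reg m)(j := reg m j - 1)"
          then show "accepts (Same i j) l"
            using Suc.hyps(1)[of l] Suc.hyps(2)[symmetric] m eq assms by simp
        qed (use m eq Suc.hyps(2) assms in auto)
      qed (use Suc in auto)
    qed
    finally show ?case .
  qed
  then show ?thesis by (simp add: sem_def)
qed

section \<open>Evaluation of recursive functions as equivalences\<close>

lemma rec_eval_Zero_iff: "rec_eval Zero xs y \<longleftrightarrow> y = 0"
  by (auto intro: rec_eval.intros elim: rec_eval_ZeroE)

lemma rec_eval_Succ_iff: "rec_eval Succ xs y \<longleftrightarrow> (\<exists>x. xs = [x] \<and> y = Suc x)"
  by (auto intro: rec_eval.intros elim: rec_eval_SuccE)

lemma rec_eval_Proj_iff: "rec_eval (Proj i) xs y \<longleftrightarrow> i < length xs \<and> y = xs ! i"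
  by (auto intro: rec_eval.intros elim: rec_eval_ProjE)

lemma rec_eval_Comp_iff: "rec_eval (Comp f gs) xs z \<longleftrightarrow>
  (\<exists>ys. length ys = length gs \<and> (\<forall>i<length gs. rec_eval (gs ! i) xs (ys ! i)) \<and> rec_eval f ys z)"
  by (auto intro: rec_eval.intros elim: rec_eval_CompE)

lemma rec_eval_PrimRec_0_iff: "rec_eval (PrimRec f g) (0 # xs) y \<longleftrightarrow> rec_eval f xs y"
  by (auto intro: rec_eval.intros elim: rec_eval_PrimRec_0E)

lemma rec_eval_PrimRec_Suc_iff: "rec_eval (PrimRec f g) (Suc n # xs) z \<longleftrightarrow>
  (\<exists>y. rec_eval (PrimRec f g) (n # xs) y \<and> rec_eval g (n # y # xs) z)"
  by (auto intro: rec_eval.intros elim: rec_eval_PrimRec_SucE)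

lemma rec_eval_Mu_iff: "rec_eval (Mu f) xs n \<longleftrightarrow>
  rec_eval f (n # xs) 0 \<and> (\<forall>m<n. \<exists>y. rec_eval f (m # xs) (Suc y))"
  by (auto intro: rec_eval.intros elim: rec_eval_MuE)

lemma rec_eval_PrimRec_Nil: "\<not> rec_eval (PrimRec f g) [] y"
  by (auto elim: rec_eval.cases)

text \<open>Induction on the recursion argument in register \<open>n\<close>, for all
  \<open>j\<close> and \<open>j'\<close> since they swap. The first player guesses the previous
  value in \<open>j'\<close>; the second examines either the step function or the previous value. In
  the latter case the content of \<open>j\<close> is no longer needed and may be
  overwritten.\<close>

lemma sem_PR:
  assumes f: "\<And>j b. distinct (j # is) \<Longrightarrow> set (j # is) \<subseteq> {..<b} \<Longrightarrow>
      sem (Claim f is j b) (\<lambda>v. rec_eval f (map v is) (v j))"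
    and g: "\<And>is j b. distinct (j # is) \<Longrightarrow> set (j # is) \<subseteq> {..<b} \<Longrightarrow>
      sem (Claim g is j b) (\<lambda>v. rec_eval g (map v is) (v j))"
    and "distinct (j # j' # n # is)" "set (j # j' # n # is) \<subseteq> {..<b}"
  shows "sem (PR f g n is j j' b) (\<lambda>v. rec_eval (PrimRec f g) (map v (n # is)) (v j))"
proof -
  have "accepts (PR f g n is j j' b) k \<longleftrightarrow>
      rec_eval (PrimRec f g) (c # map (reg k) is) (reg k j)"
    if "k > 0" "reg k n = c" for k c
    using that assms(3,4)
  proof (induction c arbitrary: k j j')
    case 0
    then have "\<not> accepts (Dec n (Havoc j' (All [Claim g (n # j' # is) j b, PR f g n is j' j b]))) k"
      using accepts_DecD[OF 0(1)] by (metis less_irrefl)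
    then have "accepts (PR f g n is j j' b) k \<longleftrightarrow> accepts (Claim f is j b) k"
      using 0 by (subst acc_iff) (simp add: accepts_Zer)
    then show ?case using 0 semD[OF f] by (simp add: rec_eval_PrimRec_0_iff)
  next
    case (Suc c)
    let ?H = "All [Claim g (n # j' # is) j b, PR f g n is j' j b]"
    have body: "accepts ?H l \<longleftrightarrow> rec_eval g (c # reg l j' # map (reg k) is) (reg k j) \<and>
        rec_eval (PrimRec f g) (c # map (reg k) is) (reg l j')"
      if l: "l > 0" "reg l = (reg k)(n := c, j' := y)" for l y
    proof -
      have nk: "reg l n = c" "reg l j = reg k j" "map (reg l) is = map (reg k) is"
        using l Suc.prems by auto
      have "accepts (PR f g n is j' j b) l \<longleftrightarrow>
          rec_eval (PrimRec f g) (c # map (reg l) is) (reg l j')"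
        using Suc.prems by (intro Suc.IH l nk) auto
      moreover have "accepts (Claim g (n # j' # is) j b) l \<longleftrightarrow>
          rec_eval g (map (reg l) (n # j' # is)) (reg l j)"
        using Suc.prems by (intro semD[OF g] l) auto
      ultimately show ?thesis using nk by (auto simp: accepts_All)
    qed
    have "accepts (PR f g n is j j' b) k \<longleftrightarrow> accepts (Dec n (Havoc j' ?H)) k"
      using Suc.prems by (subst acc_iff) (simp add: accepts_Zer)
    also have "\<dots> \<longleftrightarrow> (\<exists>y. rec_eval (PrimRec f g) (c # map (reg k) is) y \<and>
        rec_eval g (c # y # map (reg k) is) (reg k j))"
    proof
      assume "accepts (Dec n (Havoc j' ?H)) k"
      then obtain m where m: "m > 0" "accepts (Havoc j' ?H) m" "reg m = (reg k)(n := c)"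
        using accepts_DecD[OF Suc.prems(1)] Suc.prems(2) by (metis diff_Suc_1)
      then obtain l where l: "l > 0" "same_but j' m l" "accepts ?H l"
        using accepts_Havoc by blast
      then have "reg l = (reg k)(n := c, j' := reg l j')"
        using reg_same_but m by metis
      then show "\<exists>y. rec_eval (PrimRec f g) (c # map (reg k) is) y \<and>
          rec_eval g (c # y # map (reg k) is) (reg k j)"
        using body l by blast
    next
      assume "\<exists>y. rec_eval (PrimRec f g) (c # map (reg k) is) y \<and>
          rec_eval g (c # y # map (reg k) is) (reg k j)"
      then obtain y where y: "rec_eval (PrimRec f g) (c # map (reg k) is) y"
        "rec_eval g (c # y # map (reg k) is) (reg k j)" by blast
      show "accepts (Dec n (Havoc j' ?H)) k"
      proof (rule accepts_DecI)
        fix m assume m: "m > 0" "reg m = (reg k)(n := reg k n - 1)"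
        obtain l where l: "l > 0" "same_but j' m l" "reg l = (reg m)(j' := y)"
          using same_but_update[OF m(1)] by blast
        then have "accepts ?H l" using body[of l y] y m(2) Suc.prems(2) by simp
        then show "accepts (Havoc j' ?H) m" using accepts_Havoc[OF m(1)] l by blast
      qed (use Suc.prems in auto)
    qed
    finally show ?case by (simp add: rec_eval_PrimRec_Suc_iff)
  qed
  then show ?thesis by (simp add: sem_def)
qed

text \<open>Guessed values go to registers from \<open>b\<close> on, so they overwrite neither the
  arguments nor the asserted value. For a composition all intermediate values are guessed at once
  and one claim about them is examined; for a minimization the second player examines the value at
  the asserted argument or at a smaller one of his choice, where the first player guesses a positive
  value.\<close>

lemma sem_Claim:
  "distinct (j # is) \<Longrightarrow> set (j # is) \<subseteq> {..<b} \<Longrightarrow>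
     sem (Claim f is j b) (\<lambda>v. rec_eval f (map v is) (v j))"
proof (induction f arbitrary: "is" j b)
  case Zero
  show ?case using semD[OF sem_Zer[OF sem_accept]] unfolding sem_def
    by (subst acc_iff) (simp add: rec_eval_Zero_iff)
next
  case Succ
  have "accepts (Claim Succ is j b) n \<longleftrightarrow> rec_eval Succ (map (reg n) is) (reg n j)" if "n > 0" for n
  proof (cases "\<exists>i. is = [i]")
    case True
    then obtain i where i: "is = [i]" by blast
    then have "i \<noteq> j" using Succ by auto
    have "accepts (Claim Succ is j b) n \<longleftrightarrow> accepts (Dec j (Same i j)) n"
      by (subst acc_iff) (simp add: i)
    also have "\<dots> \<longleftrightarrow> reg n j > 0 \<and> reg n i = reg n j - 1"
      using semD[OF sem_Dec[OF sem_Same[OF \<open>i \<noteq> j\<close>]] that] \<open>i \<noteq> j\<close> by simp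
    also have "\<dots> \<longleftrightarrow> rec_eval Succ (map (reg n) is) (reg n j)"
      by (auto simp: i rec_eval_Succ_iff)
    finally show ?thesis .
  next
    case False
    then show ?thesis
      by (subst acc_iff) (auto simp: rec_eval_Succ_iff split: list.splits)
  qed
  then show ?case by (simp add: sem_def)
next
  case (Proj l)
  have "accepts (Claim (Proj l) is j b) n \<longleftrightarrow> rec_eval (Proj l) (map (reg n) is) (reg n j)"
    if "n > 0" for n
  proof (cases "l < length is")
    case True
    then have "is ! l \<noteq> j" using Proj by auto
    from semD[OF sem_Same[OF this] that] show ?thesis using True
      by (subst acc_iff) (auto simp: rec_eval_Proj_iff)
  next
    case False
    then show ?thesis by (subst acc_iff) (simp add: rec_eval_Proj_iff)
  qed
  then show ?case by (simp add: sem_def)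
next
  case (Comp f gs)
  define l where "l = length gs"
  let ?bs = "[b..<b + l]"
  let ?H = "All (Claim f ?bs j (b + l) # map (\<lambda>i. Claim (gs ! i) is (b + i) (b + l)) [0..<l])"
  have f: "sem (Claim f ?bs j (b + l)) (\<lambda>v. rec_eval f (map v ?bs) (v j))"
    using Comp.prems by (intro Comp.IH(1)) auto
  have g: "sem (Claim (gs ! i) is (b + i) (b + l)) (\<lambda>v. rec_eval (gs ! i) (map v is) (v (b + i)))"
    if "i < l" for i
    using Comp.prems that by (intro Comp.IH(2)) (auto simp: l_def)
  have H: "sem ?H (\<lambda>v. rec_eval f (map v ?bs) (v j) \<and>
      (\<forall>i<l. rec_eval (gs ! i) (map v is) (v (b + i))))"
    unfolding sem_def accepts_All using semD[OF f] semD[OF g] by simp (simp add: Ball_def)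
  have "(\<exists>w. (\<forall>k. k \<notin> set ?bs \<longrightarrow> w k = v k) \<and> rec_eval f (map w ?bs) (w j) \<and>
      (\<forall>i<l. rec_eval (gs ! i) (map w is) (w (b + i)))) \<longleftrightarrow>
    rec_eval (Comp f gs) (map v is) (v j)" (is "?L \<longleftrightarrow> ?R") for v
  proof
    assume ?L
    then obtain w where w: "\<forall>k. k \<notin> set ?bs \<longrightarrow> w k = v k" "rec_eval f (map w ?bs) (w j)"
      "\<forall>i<l. rec_eval (gs ! i) (map w is) (w (b + i))" by blast
    have eq: "map w is = map v is" "w j = v j" using w(1) Comp.prems by auto
    have "rec_eval (gs ! i) (map v is) (map w ?bs ! i)" if "i < l" for i
      using w(3) that unfolding eq by simp
    then show ?R unfolding rec_eval_Comp_iff using w(2)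
      by (intro exI[of _ "map w ?bs"]) (simp add: l_def eq(2))
  next
    assume ?R
    then obtain ys where ys: "length ys = l" "\<forall>i<l. rec_eval (gs ! i) (map v is) (ys ! i)"
      "rec_eval f ys (v j)" unfolding rec_eval_Comp_iff l_def by blast
    \<comment> \<open>The intermediate values are stored in the \<open>l\<close> fresh registers
      starting at \<open>b\<close>.\<close>
    define w where "w = (\<lambda>k. if b \<le> k \<and> k < b + l then ys ! (k - b) else v k)"
    have ws: "map w ?bs = ys" using ys(1) by (auto simp: w_def intro!: nth_equalityI)
    have vs: "map w is = map v is" "w j = v j" using Comp.prems by (auto simp: w_def)
    have "rec_eval (gs ! i) (map w is) (w (b + i))" if "i < l" for i
      using ys(2) that unfolding vs by (simp add: w_def)
    moreover have "\<forall>k. k \<notin> set ?bs \<longrightarrow> w k = v k" by (auto simp: w_def)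
    moreover have "rec_eval f (map w ?bs) (w j)" unfolding ws vs by (rule ys(3))
    ultimately show ?L by blast
  qed
  then have "sem (foldr Havoc ?bs ?H) (\<lambda>v. rec_eval (Comp f gs) (map v is) (v j))"
    using sem_foldr_Havoc[OF H, of ?bs] by simp
  then show ?case unfolding sem_def by (subst acc_iff) (simp add: l_def Let_def)
next
  case (PrimRec f g)
  show ?case
  proof (cases "is")
    case Nil
    then show ?thesis unfolding sem_def by (subst acc_iff) (simp add: rec_eval_PrimRec_Nil)
  next
    case (Cons n is')
    have "sem (PR f g n is' j b (Suc b)) (\<lambda>v. rec_eval (PrimRec f g) (map v (n # is')) (v j))"
      by (rule sem_PR) (use PrimRec Cons in auto)
    then show ?thesis unfolding sem_def Cons by (subst acc_iff) simp
  qed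
next
  case (Mu f)
  let ?P = "\<lambda>v. rec_eval f (map v (j # is)) (v b)"
  have f: "sem (Claim f (j # is) b (Suc b)) ?P" using Mu.prems by (intro Mu.IH) auto
  have upd: "map (v(b := x)) (j # is) = map v (j # is)"
    "map (v(j := x)) (j # is) = x # map v is" for v x
    using Mu.prems by auto
  have bj: "b \<noteq> j" using Mu.prems by auto
  have "sem (Havoc b (Zer b (Claim f (j # is) b (Suc b))))
      (\<lambda>v. \<exists>x. (v(b := x)) b = 0 \<and> ?P (v(b := x)))"
    by (intro sem_Havoc sem_Zer f)
  then have zero: "sem (Havoc b (Zer b (Claim f (j # is) b (Suc b))))
      (\<lambda>v. rec_eval f (v j # map v is) 0)"
    unfolding upd by simp
  \<comment> \<open>The increment undoes the decrement, so together they only test that the register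
    is positive.\<close>
  have "sem (Dec b (Inc b (Claim f (j # is) b (Suc b))))
      (\<lambda>v. v b > 0 \<and> ?P (v(b := v b - 1, b := Suc ((v(b := v b - 1)) b))))"
    by (rule sem_Dec[OF sem_Inc[OF f]])
  then have "sem (Dec b (Inc b (Claim f (j # is) b (Suc b)))) (\<lambda>v. v b > 0 \<and> ?P v)"
    unfolding upd by (simp add: sem_def cong: conj_cong)
  from sem_Havoc[OF this, of b]
  have pos: "sem (Havoc b (Dec b (Inc b (Claim f (j # is) b (Suc b)))))
      (\<lambda>v. \<exists>y. rec_eval f (v j # map v is) (Suc y))"
    unfolding upd by (simp add: sem_def gr0_conv_Suc) blast
  let ?D = "Dec j (Down j (Havoc b (Dec b (Inc b (Claim f (j # is) b (Suc b))))))"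
  have unch: "map (v(j := x)) is = map v is" for v x using Mu.prems by simp
  have D: "sem ?D (\<lambda>v. v j > 0 \<and> (\<forall>x\<le>v j - 1. \<exists>y. rec_eval f (x # map v is) (Suc y)))"
    using sem_Dec[OF sem_Down[OF pos, of j], of j] unfolding fun_upd_upd fun_upd_same unch .
  have "accepts (Claim (Mu f) is j b) n \<longleftrightarrow> rec_eval (Mu f) (map (reg n) is) (reg n j)"
    if n: "n > 0" for n
  proof -
    have "accepts (Claim (Mu f) is j b) n \<longleftrightarrow> rec_eval f (reg n j # map (reg n) is) 0 \<and>
      (reg n j = 0 \<or> (reg n j > 0 \<and> (\<forall>x\<le>reg n j - 1. \<exists>y. rec_eval f (x # map (reg n) is) (Suc y))))"
      using semD[OF zero n] semD[OF D n] n
      by (subst acc_iff) (simp add: accepts_Any accepts_Zer accepts_All)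
    also have "\<dots> \<longleftrightarrow> rec_eval (Mu f) (map (reg n) is) (reg n j)"
      unfolding rec_eval_Mu_iff by (cases "reg n j") (auto simp: less_Suc_eq_le)
    finally show ?thesis .
  qed
  then show ?case by (simp add: sem_def)
qed

subsection \<open>Finitely many programs are reachable\<close>

text \<open>A finite closed set of programs supplies the control states of a finite game.\<close>

definition fin_reach :: "prog \<Rightarrow> bool" where
  "fin_reach q \<longleftrightarrow> (\<exists>S. finite S \<and> q \<in> S \<and> (\<forall>x\<in>S. set_instr (step x) \<subseteq> S))"

lemma finite_set_instr: "finite (set_instr I)"
  by (cases I) auto

text \<open>Each exit from \<open>T\<close> has a finite closed set of its own, and the union of
  these with \<open>T\<close> is closed. Loops can thus be listed in \<open>T\<close> while the
  programs they lead to are treated separately.\<close>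

lemma fin_reach_closed:
  assumes "finite T" "\<And>x. x \<in> T \<Longrightarrow> set_instr (step x) \<subseteq> T \<union> {y. fin_reach y}" "q \<in> T"
  shows "fin_reach q"
proof -
  define U where "U = {y \<in> (\<Union>x\<in>T. set_instr (step x)). fin_reach y}"
  have "\<forall>y\<in>U. \<exists>S. finite S \<and> y \<in> S \<and> (\<forall>x\<in>S. set_instr (step x) \<subseteq> S)"
    by (auto simp: U_def fin_reach_def)
  then obtain S where S: "\<forall>y\<in>U. finite (S y) \<and> y \<in> S y \<and> (\<forall>x\<in>S y. set_instr (step x) \<subseteq> S y)"
    by (rule bchoice[THEN exE]) blast
  have "finite U" unfolding U_def using assms(1) by (auto simp: finite_set_instr)
  then show ?thesis unfolding fin_reach_def using S assms
    by (intro exI[of _ "T \<union> (\<Union>y\<in>U. S y)"]) (auto simp: U_def, blast+)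
qed

lemma fin_reach_step:
  assumes "\<And>x. x \<in> set_instr (step q) \<Longrightarrow> fin_reach x"
  shows "fin_reach q"
  by (rule fin_reach_closed[of "{q}"]) (use assms in auto)

lemma fin_reach_simple:
  "fin_reach q \<Longrightarrow> fin_reach (Inc i q)" "fin_reach q \<Longrightarrow> fin_reach (Dec i q)"
  "fin_reach q \<Longrightarrow> fin_reach (Zer i q)"
  "(\<And>q. q \<in> set qs \<Longrightarrow> fin_reach q) \<Longrightarrow> fin_reach (Any qs)"
  "(\<And>q. q \<in> set qs \<Longrightarrow> fin_reach q) \<Longrightarrow> fin_reach (All qs)"
  by (rule fin_reach_step; simp)+

lemma fin_reach_Havoc: "fin_reach q \<Longrightarrow> fin_reach (Havoc i q)"
  by (rule fin_reach_closed[of "{Havoc i q, Inc i (Havoc i q), Dec i (Havoc i q)}"]) auto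

lemma fin_reach_foldr_Havoc: "fin_reach q \<Longrightarrow> fin_reach (foldr Havoc bs q)"
  by (induction bs) (auto intro: fin_reach_Havoc)

lemma fin_reach_Down: "fin_reach q \<Longrightarrow> fin_reach (Down i q)"
  by (rule fin_reach_closed[of "{Down i q, Any [Zer i (All []), Dec i (Down i q)],
      Dec i (Down i q)}"]) (auto intro!: fin_reach_simple)

lemma fin_reach_Same: "fin_reach (Same i j)"
  by (rule fin_reach_closed[of "{Same i j, Dec j (Same i j), Dec i (Dec j (Same i j))}"])
    (auto intro!: fin_reach_simple)

lemma fin_reach_Claim: "fin_reach (Claim f is j b)"
proof (induction f arbitrary: "is" j b)
  case Zero
  show ?case by (rule fin_reach_step) (auto intro!: fin_reach_simple)
next
  case Succ
  show ?case by (rule fin_reach_step) (auto intro!: fin_reach_simple fin_reach_Same split: list.splits)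
next
  case (Proj l)
  show ?case by (rule fin_reach_step) (auto intro!: fin_reach_Same split: if_splits)
next
  case (Comp f gs)
  define l where "l = length gs"
  have "fin_reach (All (Claim f [b..<b + l] j (b + l) #
      map (\<lambda>i. Claim (gs ! i) is (b + i) (b + l)) [0..<l]))"
    by (rule fin_reach_simple(5)) (auto simp: l_def intro: Comp.IH)
  note fin_reach_foldr_Havoc[OF this]
  then have "fin_reach x" if "x \<in> set_instr (step (Claim (Comp f gs) is j b))" for x
    using that by (simp only: step.simps l_def Let_def instr.set list.set singleton_iff)
  then show ?case by (rule fin_reach_step)
next
  case (PrimRec f g)
  have PR: "fin_reach (PR f g n is j j' b)" for n "is" j j' b
  proof -
    let ?A = "\<lambda>j j'. All [Claim g (n # j' # is) j b, PR f g n is j' j b]"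
    let ?T = "\<lambda>j j'. {PR f g n is j j' b, Dec n (Havoc j' (?A j j')), Havoc j' (?A j j'),
      Inc j' (Havoc j' (?A j j')), Dec j' (Havoc j' (?A j j')), ?A j j'}"
    show ?thesis
      \<comment> \<open>Two unfoldings restore the order of \<open>j\<close> and \<open>j'\<close>,
        so these two phases form a closed loop.\<close>
      by (rule fin_reach_closed[of "?T j j' \<union> ?T j' j"])
        (auto intro!: fin_reach_simple PrimRec.IH)
  qed
  show ?case by (rule fin_reach_step) (auto intro!: PR split: list.splits)
next
  case (Mu f)
  then have "fin_reach x" if "x \<in> set_instr (step (Claim (Mu f) is j b))" for x
    using that by (auto intro!: fin_reach_simple fin_reach_Havoc fin_reach_Down)
  then show ?case by (rule fin_reach_step)
qed

section \<open>The code of the game as a recursive function\<close>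

definition recursive :: "nat \<Rightarrow> (nat list \<Rightarrow> nat) \<Rightarrow> bool" where
  "recursive a f \<longleftrightarrow> (\<exists>r. \<forall>xs. length xs = a \<longrightarrow> rec_eval r xs (f xs))"

definition recursive2 :: "(nat \<Rightarrow> nat \<Rightarrow> nat) \<Rightarrow> bool" where
  "recursive2 F \<longleftrightarrow> recursive 2 (\<lambda>xs. F (xs ! 0) (xs ! 1))"

lemma recursive_proj: "i < a \<Longrightarrow> recursive a (\<lambda>xs. xs ! i)"
  unfolding recursive_def by (rule exI[of _ "Proj i"]) (simp add: rec_eval.Proj)

lemma recursive_Comp1:
  assumes "\<And>x. rec_eval r [x] (F x)" "recursive a f"
  shows "recursive a (\<lambda>xs. F (f xs))"
proof -
  obtain rf where "\<And>xs. length xs = a \<Longrightarrow> rec_eval rf xs (f xs)"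
    using assms(2) by (auto simp: recursive_def)
  then have "rec_eval (Comp r [rf]) xs (F (f xs))" if "length xs = a" for xs
    using assms(1) that by (intro rec_eval.Comp[of "[f xs]"]) simp_all
  then show ?thesis by (auto simp: recursive_def)
qed

lemma recursive_Suc: "recursive a f \<Longrightarrow> recursive a (\<lambda>xs. Suc (f xs))"
  by (rule recursive_Comp1) (rule rec_eval.Succ)

lemma recursive_const: "recursive a (\<lambda>_. c)"
proof (induction c)
  case 0
  show ?case unfolding recursive_def by (rule exI[of _ Zero]) (simp add: rec_eval.Zero)
qed (rule recursive_Suc)

lemma recursive_Comp2:
  assumes "recursive2 F" "recursive a f" "recursive a g"
  shows "recursive a (\<lambda>xs. F (f xs) (g xs))"
proof -
  obtain r where r: "\<And>xs. length xs = 2 \<Longrightarrow> rec_eval r xs (F (xs ! 0) (xs ! 1))"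
    using assms(1) by (auto simp: recursive2_def recursive_def)
  obtain rf where rf: "\<And>xs. length xs = a \<Longrightarrow> rec_eval rf xs (f xs)"
    using assms(2) by (auto simp: recursive_def)
  obtain rg where rg: "\<And>xs. length xs = a \<Longrightarrow> rec_eval rg xs (g xs)"
    using assms(3) by (auto simp: recursive_def)
  have "rec_eval (Comp r [rf, rg]) xs (F (f xs) (g xs))" if "length xs = a" for xs
    using r[of "[f xs, g xs]"] rf[OF that] rg[OF that]
    by (intro rec_eval.Comp[of "[f xs, g xs]"]) (auto simp: less_Suc_eq)
  then show ?thesis by (auto simp: recursive_def)
qed

lemma recursive2_PrimRec:
  assumes base: "recursive 1 (\<lambda>xs. F 0 (xs ! 0))" and step: "recursive 3 s"
    and F: "\<And>n y. F (Suc n) y = s [n, F n y, y]"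
  shows "recursive2 F"
proof -
  obtain b where "\<forall>xs. length xs = 1 \<longrightarrow> rec_eval b xs (F 0 (xs ! 0))"
    using base by (auto simp: recursive_def)
  from spec[OF this, of "[_]"] have b: "rec_eval b [y] (F 0 y)" for y by simp
  obtain t where t: "\<And>xs. length xs = 3 \<Longrightarrow> rec_eval t xs (s xs)"
    using step by (auto simp: recursive_def)
  have rec: "rec_eval (PrimRec b t) [n, y] (F n y)" for n y
  proof (induction n)
    case (Suc n)
    then show ?case using t[of "[n, F n y, y]"] by (auto simp: F intro: rec_eval.PrimRec_Suc)
  qed (rule rec_eval.PrimRec_0[OF b])
  have "rec_eval (PrimRec b t) xs (F (xs ! 0) (xs ! 1))" if "length xs = 2" for xs
  proof -
    have "xs = [xs ! 0, xs ! 1]" using that by (cases xs; cases "tl xs") auto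
    then obtain n y where "xs = [n, y]" by blast
    then show ?thesis using rec by simp
  qed
  then show ?thesis by (auto simp: recursive2_def recursive_def)
qed

lemma recursive2_add: "recursive2 (+)"
  by (rule recursive2_PrimRec[where s="\<lambda>xs. Suc (xs ! 1)"])
    (simp_all add: recursive_Suc recursive_proj)

lemmas recursive_add = recursive_Comp2[OF recursive2_add]

lemma recursive2_mult: "recursive2 (*)"
  by (rule recursive2_PrimRec[where s="\<lambda>xs. xs ! 2 + xs ! 1"])
    (simp_all add: recursive_const recursive_add recursive_proj)

lemmas recursive_mult = recursive_Comp2[OF recursive2_mult]

lemma recursive2_power: "recursive2 (\<lambda>n y. y ^ n)"
  by (rule recursive2_PrimRec[where s="\<lambda>xs. xs ! 2 * xs ! 1"])
    (simp_all add: recursive_const recursive_mult recursive_proj)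

lemma recursive_power: "recursive a f \<Longrightarrow> recursive a (\<lambda>xs. c ^ f xs)"
  by (rule recursive_Comp2[OF recursive2_power _ recursive_const])

lemma recursive_triangle: "recursive a f \<Longrightarrow> recursive a (\<lambda>xs. triangle (f xs))"
proof -
  assume f: "recursive a f"
  \<comment> \<open>The dummy argument \<open>y\<close> fits the unary recursion into the binary
    scheme.\<close>
  have "recursive2 (\<lambda>n y. triangle n)"
    by (rule recursive2_PrimRec[where s="\<lambda>xs. xs ! 1 + Suc (xs ! 0)"])
      (simp_all add: recursive_const recursive_add recursive_Suc recursive_proj)
  from recursive_Comp2[OF this f f] show ?thesis .
qed

lemma recursive_prod_encode:
  "recursive a f \<Longrightarrow> recursive a g \<Longrightarrow> recursive a (\<lambda>xs. prod_encode (f xs, g xs))"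
  by (simp add: prod_encode_def recursive_add recursive_triangle)

lemmas recursive_intros =
  recursive_proj recursive_const recursive_Suc recursive_add recursive_mult recursive_power
  recursive_prod_encode

text \<open>The arguments fill registers 1 to 3; register 0 is left at 0, the value that will be
  asserted.\<close>

definition start_number :: "nat list \<Rightarrow> nat" where
  "start_number xs = prm 1 ^ (xs ! 0) * prm 2 ^ (xs ! 1) * prm 3 ^ (xs ! 2)"

definition init_edge_code :: "nat \<Rightarrow> nat list \<Rightarrow> nat" where
  "init_edge_code k xs = encode_edge (0, pad k (init_weight (start_number xs)), 1)"

text \<open>The arguments \<open>xs\<close> are the codes of the two sets of states and of the set of edges without
  the initial edge, whose weight depends on \<open>xs\<close>.\<close>

definition instance_code :: "nat \<Rightarrow> nat list \<Rightarrow> nat" where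
  "instance_code k xs = prod_encode
     (prod_encode (xs ! 0, prod_encode (xs ! 1, xs ! 2 + 2 ^ init_edge_code k xs)),
      prod_encode (0, list_encode (map encode_rat (replicate k 0))))"

text \<open>Unfolding the codes of lists and integers leaves only operations known to be recursive:
  a nonnegative \<open>m\<close> has code \<open>2 * m\<close> and \<open>- m - 1\<close> has code
  \<open>2 * m + 1\<close>. The code of the padding is a constant.\<close>

lemma init_edge_code_eq:
  "init_edge_code k xs = (let n = start_number xs in
     prod_encode (0, prod_encode (Suc (prod_encode (Suc (Suc (n + n)), Suc (prod_encode (2,
       Suc (prod_encode (Suc (n + n), list_encode (map int_encode (replicate (k - 3) 0)))))))), 1)))"
proof -
  have "int_encode (int n + 1) = Suc (Suc (n + n))" "int_encode (- int n - 1) = Suc (n + n)" for n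
    by (simp_all add: int_encode_def sum_encode_def nat_add_distrib)
  moreover have "int_encode 1 = 2" by (simp add: int_encode_def sum_encode_def)
  ultimately show ?thesis
    by (simp add: init_edge_code_def encode_edge_def pad_def init_weight_def Let_def)
qed

lemma recursive_instance_code: "recursive 3 (instance_code k)"
proof -
  have "recursive 3 start_number"
    unfolding start_number_def by (intro recursive_intros) simp_all
  then have "recursive 3 (init_edge_code k)"
    unfolding init_edge_code_eq Let_def by (intro recursive_intros)
  then show ?thesis
    unfolding instance_code_def by (intro recursive_intros) simp_all
qed

lemma reg_start_number:
  "reg (start_number xs) i = (if i = 1 then xs ! 0 else if i = 2 then xs ! 1
     else if i = 3 then xs ! 2 else 0)"
  by (simp add: start_number_def reg_mult reg_prm_power)

lemma start_number_pos: "start_number xs > 0"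
  by (simp add: start_number_def)

text \<open>There is no circularity: \<open>xs\<close> depends on \<open>F\<close> and
  \<open>k\<close> only, the start number is computed from \<open>xs\<close>, and it enters the game
  through the initial edge alone.\<close>

lemma game_of_recfun:
  assumes k: "3 \<le> k"
  obtains G xs where "(G, 0, replicate k 0) \<in> ae_instances k" "length xs = 3"
    "encode_instance (G, 0, replicate k 0) = instance_code k xs"
    "ae_problem (G, 0, replicate k 0) \<longleftrightarrow> rec_eval F xs 0"
proof -
  define q0 where "q0 = Claim F [1, 2, 3] 0 4"
  have "fin_reach q0" unfolding q0_def by (rule fin_reach_Claim)
  then obtain Q where Q: "finite Q" "q0 \<in> Q" "\<forall>q\<in>Q. set_instr (step q) \<subseteq> Q"
    unfolding fin_reach_def by (elim exE conjE)
  \<comment> \<open>The ends of the initial edge get the fixed names 0 and 1, so that its code can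
    be computed from \<open>xs\<close> without knowing \<open>q0\<close>; adding 2 keeps the other
    names apart.\<close>
  define h where "h = (\<lambda>x. if x = Init then 0 else if x = Ctl q0 True then 1 else to_nat x + 2)"
  have "inj h" by (rule injI) (auto simp: h_def split: if_splits)
  define E where "E = base_edges k h step Q"
  define xs where "xs = [set_encode (h ` {x\<in>st_set Q. owner0 step x}),
    set_encode (h ` {x\<in>st_set Q. \<not> owner0 step x}), set_encode (encode_edge ` E)]"
  interpret simulation step Q q0 "start_number xs" k h
    by unfold_locales (use Q k \<open>inj h\<close> in auto)
  have h01: "h Init = 0" "h (Ctl q0 True) = 1" by (simp_all add: h_def)
  define d where "d = (0 :: nat, pad k (init_weight (start_number xs)), 1 :: nat)"
  have edges: "edges G = insert d E" by (simp add: sim_game_def E_def d_def h01)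
  have "finite E" using finite_edges_G by (simp add: edges)
  \<comment> \<open>No edge of \<open>E\<close> leaves \<open>Init\<close>. Since
    \<open>set_encode\<close> is a sum of powers of 2, the initial edge then adds exactly one power
    to the code.\<close>
  have "d \<notin> E"
    using \<open>inj h\<close> by (auto simp: d_def E_def base_edges_def h01(1)[symmetric] inj_eq)
  then have "encode_edge d \<notin> encode_edge ` E" by (simp add: inj_image_mem_iff inj_encode_edge)
  then have "set_encode (encode_edge ` edges G) = set_encode (encode_edge ` E) + 2 ^ encode_edge d"
    using \<open>finite E\<close> by (simp add: edges set_encode_insert)
  then have "encode_game G = prod_encode (xs ! 0, prod_encode (xs ! 1, xs ! 2 + 2 ^ init_edge_code k xs))"
    unfolding encode_game_def init_edge_code_def d_def
    by (simp add: xs_def sim_game_def)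
  then have code: "encode_instance (G, 0, replicate k 0) = instance_code k xs"
    by (simp add: encode_instance_def instance_code_def)
  have inst: "(G, 0, replicate k 0) \<in> ae_instances k"
    using weighted_game_G states_G(3)[of Init] by (simp add: ae_instances_def h01)
  have "ae_problem (G, 0, replicate k 0) \<longleftrightarrow> accepts q0 (start_number xs)"
    using winning_iff_acc by (simp add: ae_problem_def h01)
  also have "\<dots> \<longleftrightarrow> rec_eval F (map (reg (start_number xs)) [1, 2, 3]) (reg (start_number xs) 0)"
    unfolding q0_def by (intro semD[OF sem_Claim] start_number_pos) auto
  also have "\<dots> \<longleftrightarrow> rec_eval F xs 0" by (simp add: reg_start_number xs_def)
  finally have "ae_problem (G, 0, replicate k 0) \<longleftrightarrow> rec_eval F xs 0" .
  then show ?thesis using inst code by (intro that) (simp_all add: xs_def)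
qed

section \<open>Diagonalization against a decision procedure\<close>

theorem theorem3:
  fixes k :: nat
  assumes "k \<ge> 3"
  shows "\<not> decidable_problem (ae_instances k) encode_instance ae_problem"
proof
  assume "decidable_problem (ae_instances k) encode_instance ae_problem"
  then obtain f where f: "\<And>x. x \<in> ae_instances k \<Longrightarrow>
      rec_eval f [encode_instance x] (if ae_problem x then 1 else 0)"
    by (auto simp: decidable_problem_def)
  obtain c where c: "\<And>xs. length xs = 3 \<Longrightarrow> rec_eval c xs (instance_code k xs)"
    using recursive_instance_code by (auto simp: recursive_def)
  obtain G xs where G: "(G, 0, replicate k 0) \<in> ae_instances k" "length xs = 3"
    "encode_instance (G, 0, replicate k 0) = instance_code k xs"
    "ae_problem (G, 0, replicate k 0) \<longleftrightarrow> rec_eval (Comp f [c]) xs 0"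
    using game_of_recfun[OF assms] by metis
  have "rec_eval (Comp f [c]) xs (if ae_problem (G, 0, replicate k 0) then 1 else 0)"
    by (rule rec_eval.Comp[of "[instance_code k xs]"]) (use f[OF G(1)] c[OF G(2)] G(3) in simp_all)
  \<comment> \<open>The composed function yields 1 if the first player wins and 0 otherwise, whereas
    the game is won exactly if it yields 0.\<close>
  then show False using G(4) rec_eval_deterministic by (cases "ae_problem (G, 0, replicate k 0)") fastforce+
qed

end
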